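(* Let $E,A\in\mathbb R^{n\times n}$, $B\in\mathbb R^{n\times m}$, $C\in\mathbb R^{m\times n}$ be such that the descriptor system $E\dot x=Ax+Bu$, $y=Cx$ is port-Hamiltonian. Then there exists a matrix $K\in\mathbb R^{m\times m}$ such that the pencil $(E+BKC,A)$ is regular, $\operatorname{ind}(E+BKC,A)\le 1$, $$\operatorname{rank}(E+BKC)=\max_{\hat K\in\mathbb R^{m\times m}}\operatorname{rank}(E+B\hat KC),$$ and the closed-loop system $$(E+BKC)\dot x=Ax+Bv,\qquad y=Cx$$ is port-Hamiltonian, if and only if $$\operatorname{rank}\begin{bmatrix} E & A\,\mathcal S_\infty\!\left(\begin{bmatrix}E\\ C\end{bmatrix}\right)\\ C & 0\end{bmatrix}=\operatorname{rank}\begin{bmatrix} E & A\,\mathcal S_\infty\!\left(\begin{bmatrix}E\\ C\end{bmatrix}\right) & B\end{bmatrix}=n .$$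
   Context: Port-Hamiltonian: a system $E\dot x=Ax+Bu$, $y=Cx$ with $E,A\in\mathbb R^{n\times n}$, $B\in\mathbb R^{n\times m}$, $C\in\mathbb R^{m\times n}$ is called port-Hamiltonian if there exist $J,R,Q\in\mathbb R^{n\times n}$ and $G,P\in\mathbb R^{n\times m}$ with $J=-J^T$ such that $$A=(J-R)Q,\quad B=G-P,\quad C=(G+P)^TQ,$$ $$Q^TE=E^TQ\ge 0,\quad Q^TRQ=Q^TR^TQ\ge 0,\quad Q^TP=0,$$ where $M\ge 0$ means that $M$ is symmetric positive semidefinite. $E$ and $Q$ may be singular. The closed-loop system is port-Hamiltonian if the same definition holds with the closed-loop coefficient matrices in place of $E,A,B,C$. Regularity and index: the pencil $(E,A)$ is regular if $\det(\alpha E-\beta A)\ne 0$ for some $(\alpha,\beta)\in\mathbb C^2$. For a regular pencil there are nonsingular $X,Y$ with $X(sE-A)Y=\operatorname{diag}(sI-\hat J,\ sN-I)$ with $N$ nilpotent; the index $\operatorname{ind}(E,A)$ is the degree of nilpotency of $N$ (the smallest $i$ with $N^i=0$; it is $0$ if the block $N$ is absent). A pencil is regular with index at most one if and only if it has exactly $\operatorname{rank}(E)$ finite eigenvalues (counted with multiplicity). Notation: $\mathcal S_\infty(M)$ denotes a full column rank matrix whose columns span the right nullspace of $M$ (an empty matrix if the nullspace is trivial). *)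

theory Defs
  imports "Jordan_Normal_Form.DL_Rank" "Jordan_Normal_Form.Matrix_Kernel" Complex_Main
begin

abbreviation mat_rank :: "'a :: field mat \<Rightarrow> nat" where
  "mat_rank M \<equiv> vec_space.rank (dim_row M) M"

definition append_cols :: "'a :: zero mat \<Rightarrow> 'a mat \<Rightarrow> 'a mat" where
  "append_cols A B = four_block_mat A B (0\<^sub>m 0 (dim_col A)) (0\<^sub>m 0 (dim_col B))"

definition pos_semidef :: "real mat \<Rightarrow> bool" where
  "pos_semidef M \<longleftrightarrow> M\<^sup>T = M \<and> (\<forall>x \<in> carrier_vec (dim_row M). x \<bullet> (M *\<^sub>v x) \<ge> 0)"

definition port_hamiltonian ::
    "nat \<Rightarrow> nat \<Rightarrow> real mat \<Rightarrow> real mat \<Rightarrow> real mat \<Rightarrow> real mat \<Rightarrow> bool" where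
  "port_hamiltonian n m E A B C \<longleftrightarrow>
     E \<in> carrier_mat n n \<and> A \<in> carrier_mat n n \<and> B \<in> carrier_mat n m \<and> C \<in> carrier_mat m n \<and>
     (\<exists>J \<in> carrier_mat n n. \<exists>R \<in> carrier_mat n n. \<exists>Q \<in> carrier_mat n n.
      \<exists>G \<in> carrier_mat n m. \<exists>P \<in> carrier_mat n m.
        J = - J\<^sup>T \<and>
        A = (J - R) * Q \<and> B = G - P \<and> C = (G + P)\<^sup>T * Q \<and>
        Q\<^sup>T * E = E\<^sup>T * Q \<and> pos_semidef (Q\<^sup>T * E) \<and>
        Q\<^sup>T * R * Q = Q\<^sup>T * R\<^sup>T * Q \<and> pos_semidef (Q\<^sup>T * R * Q) \<and>
        Q\<^sup>T * P = 0\<^sub>m n m)"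

abbreviation cmat :: "real mat \<Rightarrow> complex mat" where
  "cmat \<equiv> map_mat complex_of_real"

definition regular_pencil :: "real mat \<Rightarrow> real mat \<Rightarrow> bool" where
  "regular_pencil E A \<longleftrightarrow>
     (\<exists>\<alpha> \<beta> :: complex. det (\<alpha> \<cdot>\<^sub>m cmat E - \<beta> \<cdot>\<^sub>m cmat A) \<noteq> 0)"

text \<open>
  \<open>weierstrass_form n E A p N\<close>: for some invertible \<open>X\<close>, \<open>Y\<close> the pencil \<open>X(sE - A)Y\<close> is
  \<open>diag(sI - J, sN - I)\<close> with \<open>N\<close> nilpotent of size \<open>p \<times> p\<close>; \<open>p = 0\<close> means
  that the block \<open>N\<close> is absent, and \<open>q = 0\<close> that the block \<open>J\<close> is absent.
\<close>
definition weierstrass_form ::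
    "nat \<Rightarrow> real mat \<Rightarrow> real mat \<Rightarrow> nat \<Rightarrow> complex mat \<Rightarrow> bool" where
  "weierstrass_form n E A p N \<longleftrightarrow>
     N \<in> carrier_mat p p \<and> (\<exists>i. N ^\<^sub>m i = 0\<^sub>m p p) \<and>
     (\<exists>q. \<exists>J \<in> carrier_mat q q. \<exists>X \<in> carrier_mat n n. \<exists>Y \<in> carrier_mat n n.
        q + p = n \<and> invertible_mat X \<and> invertible_mat Y \<and>
        (\<forall>s :: complex. X * (s \<cdot>\<^sub>m cmat E - cmat A) * Y =
           four_block_mat (s \<cdot>\<^sub>m 1\<^sub>m q - J) (0\<^sub>m q p) (0\<^sub>m p q) (s \<cdot>\<^sub>m N - 1\<^sub>m p)))"

definition nilpotency_degree :: "complex mat \<Rightarrow> nat" where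
  "nilpotency_degree N = (LEAST i. N ^\<^sub>m i = 0\<^sub>m (dim_row N) (dim_row N))"

text \<open>
  All Weierstrass forms of a regular pencil have the same nilpotency degree, so \<open>LEAST\<close> only
  selects this common value. The value is unspecified for pencils that are not regular. If
  \<open>N\<close> is \<open>0 \<times> 0\<close>, its zeroth power is already zero and the index is 0.
\<close>
definition pencil_index :: "real mat \<Rightarrow> real mat \<Rightarrow> nat" where
  "pencil_index E A =
     (LEAST \<nu>. \<exists>p N. weierstrass_form (dim_row E) E A p N \<and> nilpotency_degree N = \<nu>)"

text \<open>
  \<open>S\<close> is a full column rank matrix whose columns span the right nullspace of \<open>M\<close>. It has no
  columns if the nullspace is trivial.
\<close>
definition right_null_basis :: "'a :: field mat \<Rightarrow> 'a mat \<Rightarrow> bool" where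
  "right_null_basis M S \<longleftrightarrow>
     dim_row S = dim_col M \<and> mat_rank S = dim_col S \<and>
     vec_space.col_space (dim_row S) S = mat_kernel M"

end

theory Submission
  imports Defs "Jordan_Normal_Form.Jordan_Normal_Form_Existence"
begin

text \<open>
  The feedback \<open>K = I\<close> does it whenever some feedback does. For a port-Hamiltonian system
  \<open>Q\<^sup>T P = 0\<close> yields \<open>C = B\<^sup>T Q\<close>, so \<open>Q\<^sup>T (E + B C) = Q\<^sup>T E + C\<^sup>T C\<close> is
  again symmetric and positive semidefinite: the closed loop keeps the structure with the same
  \<open>J, R, Q, G, P\<close>. The same identity shows that \<open>(E + B C) x = 0\<close> forces \<open>E x = 0\<close> and
  \<open>C x = 0\<close>. As no feedback can act on such vectors, the maximal rank is that of \<open>E\<close> stacked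
  on \<open>C\<close>, and \<open>K = I\<close> attains it.

  What remains is regularity and index at most one. For a regular pencil \<open>(E, A)\<close> the latter means
  that \<open>E z = 0\<close> and \<open>A z = E x\<close> imply \<open>z = 0\<close>
  (\<open>pencil_index_le_1_iff\<close>). Behind this is the existence of the Weierstrass form
  (\<open>weierstrass_form_exists\<close>), obtained from the Jordan form of \<open>T\<^sup>-\<^sup>1 E\<close> for an
  invertible member \<open>T\<close> of the pencil by separating the eigenvalue zero.

  Necessity of the rank conditions: if a feedback \<open>K\<close> attains the maximal rank, the kernel of
  \<open>E + B K C\<close> is spanned by \<open>S\<close>. Index at most one then makes \<open>[E + B K C, A S]\<close>
  surjective, and a fortiori \<open>[E, A S, B]\<close>; the first condition is the index condition restricted to
  vectors \<open>x\<close> with \<open>C x = 0\<close> (\<open>feedback_rank_conditions_necessary\<close>).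

  Sufficiency: if \<open>z\<close> violates regularity or the index condition for \<open>K = I\<close>, pairing the
  violated equation with \<open>Q z\<close> shows that \<open>z\<close> does not dissipate, \<open>z\<^sup>T Q\<^sup>T R Q z = 0\<close>.
  Then \<open>Q z\<close> is a left null vector of \<open>[E, A S, B]\<close>, so it vanishes by the second rank
  condition. Since \<open>A = (J - R) Q\<close>, this gives \<open>A z = 0\<close>, and the first rank condition excludes
  \<open>z \<noteq> 0\<close> (\<open>unit_feedback_regular_separated\<close>).
\<close>

section \<open>Matrix and vector identities\<close>

lemma smult_mat_mult_vec:
  "A \<in> carrier_mat nr nc \<Longrightarrow> v \<in> carrier_vec nc \<Longrightarrow> (k \<cdot>\<^sub>m A) *\<^sub>v v = k \<cdot>\<^sub>v (A *\<^sub>v v)"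
  for k :: "'a::comm_ring_1"
  by (intro eq_vecI) auto

lemma zero_mat_mult_vec: "v \<in> carrier_vec nc \<Longrightarrow> 0\<^sub>m nr nc *\<^sub>v v = 0\<^sub>v nr"
  for v :: "'a::semiring_0 vec"
  by (intro eq_vecI) auto

lemma mult_mat_zero_vec: "M \<in> carrier_mat nr nc \<Longrightarrow> M *\<^sub>v 0\<^sub>v nc = 0\<^sub>v nr"
  for M :: "'a::semiring_0 mat"
  by (intro eq_vecI) auto

lemma mult_mat_uminus_vec:
  fixes M :: "'a::comm_ring_1 mat"
  assumes "M \<in> carrier_mat r c" "v \<in> carrier_vec c"
  shows "M *\<^sub>v (- v) = - (M *\<^sub>v v)"
  using assms by (intro eq_vecI) auto

lemma vec_minus_eq_0D:
  fixes u v :: "'a::group_add vec"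
  assumes u: "u \<in> carrier_vec n" and v: "v \<in> carrier_vec n" and zero: "u - v = 0\<^sub>v n"
  shows "u = v"
proof (rule eq_vecI)
  fix i assume "i < dim_vec v"
  then show "u $ i = v $ i" using arg_cong[OF zero, of "\<lambda>w. w $ i"] v by simp
qed (use u v in simp)

lemma mult_vec_add_eq_0_iff:
  fixes E A :: "'a::comm_ring_1 mat"
  assumes E: "E \<in> carrier_mat r n" and A: "A \<in> carrier_mat r k"
    and x: "x \<in> carrier_vec n" and z: "z \<in> carrier_vec k"
  shows "E *\<^sub>v x + A *\<^sub>v z = 0\<^sub>v r \<longleftrightarrow> A *\<^sub>v z = E *\<^sub>v (- x)"
proof -
  have "A *\<^sub>v z = - (E *\<^sub>v x)" if zero: "E *\<^sub>v x + A *\<^sub>v z = 0\<^sub>v r"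
  proof (rule eq_vecI)
    fix i assume "i < dim_vec (- (E *\<^sub>v x))"
    then have i: "i < r" using E by simp
    have "(E *\<^sub>v x + A *\<^sub>v z) $ i = 0" unfolding zero using i by simp
    then show "(A *\<^sub>v z) $ i = (- (E *\<^sub>v x)) $ i"
      using i E A by (simp add: eq_neg_iff_add_eq_0 add.commute del: index_mult_mat_vec)
  qed (use E A in simp)
  moreover have "E *\<^sub>v x + A *\<^sub>v z = 0\<^sub>v r" if "A *\<^sub>v z = - (E *\<^sub>v x)"
    unfolding that using E by (intro eq_vecI) auto
  ultimately show ?thesis unfolding mult_mat_uminus_vec[OF E x] by blast
qed

lemma vec_split_append:
  assumes "u \<in> carrier_vec (a + b)"
  obtains x y where "x \<in> carrier_vec a" "y \<in> carrier_vec b" "u = x @\<^sub>v y"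
  using that[of "vec_first u a" "vec_last u b"] assms by simp

lemma scalar_prod_self_eq_0_iff:
  fixes v :: "real vec"
  assumes "v \<in> carrier_vec n"
  shows "v \<bullet> v = 0 \<longleftrightarrow> v = 0\<^sub>v n"
proof
  assume "v \<bullet> v = 0"
  then have "\<forall>i\<in>{0..<n}. v $ i * v $ i = 0"
    using assms by (subst sum_nonneg_eq_0_iff[symmetric]) (auto simp: scalar_prod_def)
  then show "v = 0\<^sub>v n" using assms by (intro eq_vecI) auto
qed (use assms in simp)

lemma scalar_prod_self_nonneg: "v \<bullet> v \<ge> (0::real)"
  by (auto simp: scalar_prod_def intro!: sum_nonneg)

lemma append_rows_mult_vec_eq_0_iff:
  fixes E C :: "'a::comm_ring_1 mat"
  assumes "E \<in> carrier_mat r n" "C \<in> carrier_mat m n" "x \<in> carrier_vec n"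
  shows "(E @\<^sub>r C) *\<^sub>v x = 0\<^sub>v (r + m) \<longleftrightarrow> E *\<^sub>v x = 0\<^sub>v r \<and> C *\<^sub>v x = 0\<^sub>v m"
proof -
  have zero: "0\<^sub>v (r + m) = 0\<^sub>v r @\<^sub>v (0\<^sub>v m :: 'a vec)" by auto
  show ?thesis unfolding mat_mult_append[OF assms] zero
    by (rule append_vec_eq[of _ r]) (use assms in auto)
qed

lemma append_cols_carrier:
  "D \<in> carrier_mat r a \<Longrightarrow> D' \<in> carrier_mat r b \<Longrightarrow> append_cols D D' \<in> carrier_mat r (a + b)"
  unfolding append_cols_def by (intro carrier_matI) auto

lemma append_cols_mult_vec:
  assumes "D \<in> carrier_mat r a" "D' \<in> carrier_mat r b" "x \<in> carrier_vec a" "y \<in> carrier_vec b"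
  shows "append_cols D D' *\<^sub>v (x @\<^sub>v y) = D *\<^sub>v x + D' *\<^sub>v y"
proof -
  have d: "dim_col D = a" "dim_col D' = b" using assms by auto
  have "append_cols D D' *\<^sub>v (x @\<^sub>v y) = (D *\<^sub>v x + D' *\<^sub>v y) @\<^sub>v (0\<^sub>m 0 a *\<^sub>v x + 0\<^sub>m 0 b *\<^sub>v y)"
    unfolding append_cols_def d
    by (rule four_block_mat_mult_vec[OF assms(1,2) zero_carrier_mat zero_carrier_mat assms(3,4)])
  also have "\<dots> = D *\<^sub>v x + D' *\<^sub>v y" using assms by (intro eq_vecI) auto
  finally show ?thesis .
qed

lemma four_block_mat_eq_append_cols:
  assumes "E \<in> carrier_mat r n" "X \<in> carrier_mat r k" "C \<in> carrier_mat m n"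
  shows "four_block_mat E X C (0\<^sub>m m k) = append_cols (E @\<^sub>r C) (X @\<^sub>r 0\<^sub>m m k)"
  unfolding append_cols_def append_rows_def using assms by (intro eq_matI) auto

lemma obtain_inverse_mat:
  fixes A :: "'a::field mat"
  assumes A: "A \<in> carrier_mat n n" and d: "det A \<noteq> 0"
  obtains B where "B \<in> carrier_mat n n" "A * B = 1\<^sub>m n" "B * A = 1\<^sub>m n"
  using det_non_zero_imp_unit[OF A d, of "()"] that
  unfolding Units_def ring_mat_def by auto

lemma invertible_matI:
  assumes "A \<in> carrier_mat n n" "B \<in> carrier_mat n n" "A * B = 1\<^sub>m n" "B * A = 1\<^sub>m n"
  shows "invertible_mat A"
  using assms unfolding invertible_mat_def inverts_mat_def by auto

lemma invertible_matE:
  assumes "invertible_mat A" "A \<in> carrier_mat n n"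
  obtains B where "B \<in> carrier_mat n n" "A * B = 1\<^sub>m n" "B * A = 1\<^sub>m n"
proof -
  obtain B where B: "A * B = 1\<^sub>m n" "B * A = 1\<^sub>m (dim_row B)"
    using assms unfolding invertible_mat_def inverts_mat_def by auto
  have "B \<in> carrier_mat n n"
    using arg_cong[OF B(1), of dim_col] arg_cong[OF B(2), of dim_col] assms(2) by auto
  with B that show ?thesis by auto
qed

lemma mult_inverse_cancel_left:
  fixes A B C :: "'a::semiring_1 mat"
  assumes "A \<in> carrier_mat n n" "B \<in> carrier_mat n n" "A * B = 1\<^sub>m n" "C \<in> carrier_mat n k"
  shows "A * (B * C) = C"
  using assms assoc_mult_mat[of A n n B n C k] by simp

section \<open>Rank and null space\<close>

text \<open>
  The abstract rank-nullity theorem for linear maps, applied to multiplication by \<open>M\<close>: the rank is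
  by definition the dimension of the column space, which is the image of that map.
\<close>

lemma rank_plus_kernel_dim:
  fixes M :: "'a::field mat"
  assumes M: "M \<in> carrier_mat nr nc"
  shows "vec_space.rank nr M + kernel_dim M = nc"
proof -
  interpret W: vec_space "TYPE('a)" nr .
  interpret K: kernel nr nc M by unfold_locales (rule M)
  have hom: "(*\<^sub>v) M \<in> LinearCombinations.module_hom class_ring K.NC.V W.V"
    unfolding LinearCombinations.module_hom_def
    using M by (auto simp: module_vec_simps mult_add_distrib_mat_vec[OF M] mult_mat_vec[OF M])
  have lm: "linear_map class_ring K.NC.V W.V ((*\<^sub>v) M)"
    by (rule linear_map.intro[OF K.NC.vectorspace_axioms W.vectorspace_axioms],
        rule mod_hom.intro[OF K.NC.module_axioms W.module_axioms], rule mod_hom_axioms.intro[OF hom])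
  note mh = linear_map.axioms(3)[OF lm]
  have ker: "mod_hom.ker K.NC.V W.V ((*\<^sub>v) M) = mat_kernel M"
    using M by (auto simp: mod_hom.ker_def[OF mh] mat_kernel[OF M] module_vec_simps)
  have im: "mod_hom.im K.NC.V ((*\<^sub>v) M) = W.col_space M"
    using M by (auto simp: mod_hom.im_def[OF mh] W.col_space_eq[OF M] module_vec_simps)
  have "vectorspace.dim class_ring (W.vs (W.col_space M)) + K.dim = K.NC.dim"
    using linear_map.rank_nullity[OF lm K.NC.fin_dim] unfolding ker im .
  then show ?thesis
    unfolding W.rank_def W.col_space_def K.NC.dim_is_n K.kernel_dim .
qed

lemma kernel_dim_mono:
  fixes M M' :: "'a::field mat"
  assumes M: "M \<in> carrier_mat nr nc" and M': "M' \<in> carrier_mat nr' nc"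
    and sub: "mat_kernel M \<subseteq> mat_kernel M'"
  shows "kernel_dim M \<le> kernel_dim M'"
    and "kernel_dim M = kernel_dim M' \<Longrightarrow> mat_kernel M = mat_kernel M'"
proof -
  interpret K: kernel nr nc M by unfold_locales (rule M)
  interpret K': kernel nr' nc M' by unfold_locales (rule M')
  obtain B where B: "finite B" "K.basis B" using kernel_basis_exists[OF M] by auto
  have BK: "B \<subseteq> mat_kernel M" and li: "K.lin_indpt B" and sp: "K.span B = mat_kernel M"
    using B(2) unfolding K.Ker.basis_def by auto
  have BK': "B \<subseteq> mat_kernel M'" using BK sub by auto
  have li': "K'.lin_indpt B"
    using li K.lindep_same[OF BK] K'.lindep_same[OF BK'] by simp
  have card: "card B = kernel_dim M" using K.Ker.dim_basis[OF B] by simp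
  obtain B' where B': "finite B'" "K'.basis B'" using kernel_basis_exists[OF M'] by auto
  have fd: "K'.Ker.fin_dim" using B' unfolding K'.Ker.fin_dim_def K'.Ker.basis_def by auto
  show "kernel_dim M \<le> kernel_dim M'"
    using K'.Ker.li_le_dim(2)[OF fd _ li'] BK' card by simp
  show "mat_kernel M = mat_kernel M'" if "kernel_dim M = kernel_dim M'"
  proof -
    have "K'.basis B"
      using K'.Ker.dim_li_is_basis[OF fd B(1) _ li'] BK' card that by simp
    then have "K'.span B = mat_kernel M'" unfolding K'.Ker.basis_def by auto
    then show ?thesis using sp K.span_same[OF BK] K'.span_same[OF BK'] by simp
  qed
qed

lemma kernel_dim_eq_0_iff:
  fixes M :: "'a::field mat"
  assumes M: "M \<in> carrier_mat nr nc"
  shows "kernel_dim M = 0 \<longleftrightarrow> mat_kernel M = {0\<^sub>v nc}"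
proof -
  have one: "mat_kernel (1\<^sub>m nc :: 'a mat) = {0\<^sub>v nc}"
    by (auto simp: mat_kernel[OF one_carrier_mat])
  have kd: "kernel_dim (1\<^sub>m nc :: 'a mat) = 0"
    using kernel_one_mat(1)[where 'a='a and n=nc] by (simp add: kernel_dim_def)
  have sub: "mat_kernel (1\<^sub>m nc) \<subseteq> mat_kernel M"
    unfolding one using M by (auto simp: mat_kernel[OF M])
  show ?thesis
    using kernel_dim_mono[OF one_carrier_mat M sub] kernel_dim_mono(1)[OF M one_carrier_mat[of nc]] one kd by fastforce
qed

text \<open>
  By rank-nullity, a matrix with a larger kernel has a smaller rank, and equality of the ranks forces
  equality of the kernels. All rank conditions of the theorem become statements about vectors this way.
\<close>

lemma rank_antimono_kernel:
  fixes M M' :: "'a::field mat"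
  assumes M: "M \<in> carrier_mat nr nc" and M': "M' \<in> carrier_mat nr' nc"
    and sub: "mat_kernel M \<subseteq> mat_kernel M'"
  shows "vec_space.rank nr' M' \<le> vec_space.rank nr M"
    and "vec_space.rank nr' M' = vec_space.rank nr M \<longleftrightarrow> mat_kernel M = mat_kernel M'"
proof -
  have kd: "mat_kernel M = mat_kernel M' \<Longrightarrow> kernel_dim M = kernel_dim M'"
    using M M' by (simp add: kernel_dim_def)
  note rn = rank_plus_kernel_dim[OF M] rank_plus_kernel_dim[OF M']
  note km = kernel_dim_mono[OF M M' sub]
  show "vec_space.rank nr' M' \<le> vec_space.rank nr M" using rn km by linarith
  show "vec_space.rank nr' M' = vec_space.rank nr M \<longleftrightarrow> mat_kernel M = mat_kernel M'"
    using rn km kd by linarith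
qed

lemma rank_eq_dim_row_iff_surj:
  fixes M :: "'a::field mat"
  assumes M: "M \<in> carrier_mat nr nc"
  shows "vec_space.rank nr M = nr \<longleftrightarrow> (\<forall>v\<in>carrier_vec nr. \<exists>u\<in>carrier_vec nc. M *\<^sub>v u = v)"
proof -
  interpret W: vec_space "TYPE('a)" nr .
  have cs: "W.col_space M = {v \<in> carrier_vec nr. \<exists>u\<in>carrier_vec nc. M *\<^sub>v u = v}"
    using M by (simp add: W.col_space_eq[OF M])
  have cols: "set (cols M) \<subseteq> carrier_vec nr" using M cols_dim[of M] by auto
  have "W.rank M = nr \<longleftrightarrow> W.col_space M = carrier_vec nr"
  proof
    assume r: "W.rank M = nr"
    let ?D = "W.vs (W.span (set (cols M)))"
    interpret D: vectorspace class_ring ?D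
      by (rule W.subspace_is_vs[OF W.span_is_subspace[OF cols]])
    have fd: "D.fin_dim" by (rule W.fin_dim_span_cols[OF M])
    \<comment> \<open>A basis of the column space with \<open>nr\<close> elements is already a basis of the whole space.\<close>
    obtain B where B: "finite B" "D.basis B" using D.finite_basis_exists[OF fd] by auto
    have BD: "B \<subseteq> W.span (set (cols M))" using B(2) unfolding D.basis_def by auto
    have "card B = W.dim" using D.dim_basis[OF B] r by (simp add: W.rank_def W.dim_is_n)
    moreover have "W.lin_indpt B"
      using B(2) W.span_li_not_depend(2)[OF BD W.span_is_submodule[OF cols]] unfolding D.basis_def by auto
    moreover have BV: "B \<subseteq> carrier_vec nr" using BD W.span_closed[OF cols] by auto
    ultimately have "W.basis B" using W.dim_li_is_basis[OF W.fin_dim B(1)] by simp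
    then have "carrier_vec nr \<subseteq> W.span B" unfolding W.basis_def by auto
    also have "\<dots> \<subseteq> W.span (set (cols M))"
      by (rule W.span_is_subset[OF BD W.span_is_submodule[OF cols]])
    finally show "W.col_space M = carrier_vec nr" unfolding cs W.col_space_def[symmetric] by auto
  next
    assume "W.col_space M = carrier_vec nr"
    then have "W.rank M = vectorspace.dim class_ring (W.vs (carrier_vec nr))"
      unfolding W.rank_def W.col_space_def by (rule arg_cong)
    also have "W.vs (carrier_vec nr) = W.V" by (simp add: module_vec_def)
    finally show "W.rank M = nr" unfolding W.dim_is_n .
  qed
  then show ?thesis unfolding cs by blast
qed

lemma right_null_basisD:
  fixes M S :: "'a::field mat"
  assumes S: "right_null_basis M S" and M: "M \<in> carrier_mat nr nc" and k: "k = dim_col S"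
  shows "S \<in> carrier_mat nc k"
    and "y \<in> carrier_vec k \<Longrightarrow> M *\<^sub>v (S *\<^sub>v y) = 0\<^sub>v nr"
    and "v \<in> carrier_vec nc \<Longrightarrow> M *\<^sub>v v = 0\<^sub>v nr \<Longrightarrow> \<exists>y\<in>carrier_vec k. v = S *\<^sub>v y"
    and "y \<in> carrier_vec k \<Longrightarrow> S *\<^sub>v y = 0\<^sub>v nc \<Longrightarrow> y = 0\<^sub>v k"
    and "vec_space.rank nr M + k = nc"
proof -
  interpret N: vec_space "TYPE('a)" nc .
  have dM: "dim_row M = nr" "dim_col M = nc" using M by auto
  have dS: "dim_row S = nc" and sp: "N.col_space S = mat_kernel M" and r: "N.rank S = k"
    using S unfolding right_null_basis_def dM k by auto
  show Sc: "S \<in> carrier_mat nc k" by (rule carrier_matI[OF dS k[symmetric]])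
  have ker: "v \<in> mat_kernel M \<longleftrightarrow> v \<in> carrier_vec nc \<and> (\<exists>y\<in>carrier_vec k. S *\<^sub>v y = v)" for v
    unfolding sp[symmetric] N.col_space_eq[OF Sc] dS k[symmetric] by blast
  show "M *\<^sub>v (S *\<^sub>v y) = 0\<^sub>v nr" if "y \<in> carrier_vec k"
  proof (rule mat_kernelD(2)[OF M])
    show "S *\<^sub>v y \<in> mat_kernel M" unfolding ker using mult_mat_vec_carrier[OF Sc that] that by blast
  qed
  show "\<exists>y\<in>carrier_vec k. v = S *\<^sub>v y" if "v \<in> carrier_vec nc" "M *\<^sub>v v = 0\<^sub>v nr"
    using mat_kernelI[OF M that] unfolding ker by blast
  have "kernel_dim S = 0" using rank_plus_kernel_dim[OF Sc] r by linarith
  then have "mat_kernel S = {0\<^sub>v k}" using kernel_dim_eq_0_iff[OF Sc] by blast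
  then show "y = 0\<^sub>v k" if "y \<in> carrier_vec k" "S *\<^sub>v y = 0\<^sub>v nc"
    using mat_kernelI[OF Sc that] by blast
  have "kernel_dim M = N.rank S"
    unfolding kernel_dim_def N.rank_def sp[unfolded N.col_space_def] dM ..
  then show "vec_space.rank nr M + k = nc"
    using rank_plus_kernel_dim[OF M] r by linarith
qed

lemma right_null_basisI:
  fixes M S :: "'a::field mat"
  assumes M: "M \<in> carrier_mat nr nc" and S: "S \<in> carrier_mat nc k"
    and inj: "\<And>y. y \<in> carrier_vec k \<Longrightarrow> S *\<^sub>v y = 0\<^sub>v nc \<Longrightarrow> y = 0\<^sub>v k"
    and range: "\<And>v. v \<in> carrier_vec nc \<Longrightarrow> M *\<^sub>v v = 0\<^sub>v nr \<longleftrightarrow> (\<exists>y\<in>carrier_vec k. v = S *\<^sub>v y)"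
  shows "right_null_basis M S"
proof -
  interpret N: vec_space "TYPE('a)" nc .
  have dM: "dim_row M = nr" "dim_col M = nc" and dS: "dim_row S = nc" "dim_col S = k" using M S by auto
  have "mat_kernel S = {0\<^sub>v k}"
  proof (intro subset_antisym subsetI)
    show "y \<in> {0\<^sub>v k}" if "y \<in> mat_kernel S" for y using inj mat_kernelD[OF S that] by blast
    have "S *\<^sub>v 0\<^sub>v k = 0\<^sub>v nc" using S by (intro eq_vecI) auto
    then show "y \<in> mat_kernel S" if "y \<in> {0\<^sub>v k}" for y using that mat_kernelI[OF S] by auto
  qed
  then have "kernel_dim S = 0" using kernel_dim_eq_0_iff[OF S] by blast
  then have "N.rank S = k" using rank_plus_kernel_dim[OF S] by linarith
  moreover have "N.col_space S = mat_kernel M"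
    unfolding N.col_space_eq[OF S] mat_kernel[OF M] dS
    using range mult_mat_vec_carrier[OF S] by blast
  ultimately show ?thesis unfolding right_null_basis_def dM dS by blast
qed

text \<open>
  The kernel of \<open>[D, D']\<close> contains \<open>ker F\<close>, padded with zeros, which has the dimension
  \<open>k\<close> of the null space of \<open>F\<close>. So the rank is at most \<open>n + k - k = n\<close>, and it equals
  \<open>n\<close> exactly if the kernel contains nothing else. Both block matrices of the theorem that
  contain \<open>A * S\<close> as last columns are instances: \<open>D\<close> is the open-loop stack or the closed-loop matrix.
\<close>

lemma rank_append_cols_eq_iff:
  fixes F D D' S :: "'a::field mat"
  assumes F: "F \<in> carrier_mat s n" and D: "D \<in> carrier_mat r n" and D': "D' \<in> carrier_mat r k"
    and S: "right_null_basis F S" and k: "k = dim_col S"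
    and FD: "\<And>x. x \<in> carrier_vec n \<Longrightarrow> F *\<^sub>v x = 0\<^sub>v s \<Longrightarrow> D *\<^sub>v x = 0\<^sub>v r"
  shows "vec_space.rank r (append_cols D D') = n \<longleftrightarrow>
    (\<forall>x\<in>carrier_vec n. \<forall>y\<in>carrier_vec k. D *\<^sub>v x + D' *\<^sub>v y = 0\<^sub>v r \<longrightarrow> F *\<^sub>v x = 0\<^sub>v s \<and> y = 0\<^sub>v k)"
proof -
  let ?M = "append_cols D D'"
  let ?M' = "four_block_mat F (0\<^sub>m s k) (0\<^sub>m k n) (1\<^sub>m k)"
  have Mc: "?M \<in> carrier_mat r (n + k)" by (rule append_cols_carrier[OF D D'])
  have Mc': "?M' \<in> carrier_mat (s + k) (n + k)" using F by simp
  note Sd = right_null_basisD[OF S F k]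
  have zero: "0\<^sub>v (s + k) = 0\<^sub>v s @\<^sub>v (0\<^sub>v k :: 'a vec)" by auto
  have ker': "?M' *\<^sub>v (x @\<^sub>v y) = 0\<^sub>v (s + k) \<longleftrightarrow> F *\<^sub>v x = 0\<^sub>v s \<and> y = 0\<^sub>v k"
    if xy: "x \<in> carrier_vec n" "y \<in> carrier_vec k" for x y
  proof -
    have Fx: "F *\<^sub>v x \<in> carrier_vec s" using F xy by simp
    have "?M' *\<^sub>v (x @\<^sub>v y) = (F *\<^sub>v x + 0\<^sub>m s k *\<^sub>v y) @\<^sub>v (0\<^sub>m k n *\<^sub>v x + 1\<^sub>m k *\<^sub>v y)"
      by (rule four_block_mat_mult_vec[OF F _ _ _ xy]) auto
    also have "\<dots> = (F *\<^sub>v x) @\<^sub>v y" using Fx xy by (simp add: zero_mat_mult_vec)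
    finally show ?thesis unfolding zero using append_vec_eq[OF Fx, of "0\<^sub>v s"] by simp
  qed
  \<comment> \<open>The reference matrix \<open>?M'\<close> has rank \<open>n\<close>, since padding \<open>S\<close> with zero rows gives a
    basis of its null space.\<close>
  let ?T = "S @\<^sub>r 0\<^sub>m k k"
  have T: "?T \<in> carrier_mat (n + k) k" using Sd(1) by simp
  have Ty: "?T *\<^sub>v y = (S *\<^sub>v y) @\<^sub>v 0\<^sub>v k" if "y \<in> carrier_vec k" for y
    using mat_mult_append[OF Sd(1) zero_carrier_mat that, of k] zero_mat_mult_vec[OF that] by simp
  have zero': "0\<^sub>v (n + k) = 0\<^sub>v n @\<^sub>v (0\<^sub>v k :: 'a vec)" by auto
  have "right_null_basis ?M' ?T"
  proof (rule right_null_basisI[OF Mc' T])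
    fix y :: "'a vec" assume y: "y \<in> carrier_vec k" and "?T *\<^sub>v y = 0\<^sub>v (n + k)"
    then have "S *\<^sub>v y = 0\<^sub>v n"
      unfolding Ty[OF y] zero' using append_vec_eq[of "S *\<^sub>v y" n "0\<^sub>v n"] Sd(1) y by simp
    then show "y = 0\<^sub>v k" by (rule Sd(4)[OF y])
  next
    fix v :: "'a vec" assume "v \<in> carrier_vec (n + k)"
    then obtain x z where v: "x \<in> carrier_vec n" "z \<in> carrier_vec k" "v = x @\<^sub>v z" by (rule vec_split_append)
    have "F *\<^sub>v x = 0\<^sub>v s \<and> z = 0\<^sub>v k \<longleftrightarrow> (\<exists>y\<in>carrier_vec k. x = S *\<^sub>v y \<and> z = 0\<^sub>v k)"
      using Sd(2) Sd(3)[OF v(1)] by blast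
    also have "\<dots> \<longleftrightarrow> (\<exists>y\<in>carrier_vec k. v = ?T *\<^sub>v y)"
    proof (rule bex_cong[OF refl])
      fix y :: "'a vec" assume y: "y \<in> carrier_vec k"
      show "x = S *\<^sub>v y \<and> z = 0\<^sub>v k \<longleftrightarrow> v = ?T *\<^sub>v y"
        unfolding Ty[OF y] v(3) using append_vec_eq[OF v(1), of "S *\<^sub>v y"] Sd(1) y by simp
    qed
    finally show "?M' *\<^sub>v v = 0\<^sub>v (s + k) \<longleftrightarrow> (\<exists>y\<in>carrier_vec k. v = ?T *\<^sub>v y)"
      unfolding v(3) ker'[OF v(1,2)] .
  qed
  moreover have "k = dim_col ?T" using T by simp
  ultimately have "vec_space.rank (s + k) ?M' + k = n + k" by (rule right_null_basisD(5)[OF _ Mc'])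
  then have rank': "vec_space.rank (s + k) ?M' = n" by simp
  have sub: "mat_kernel ?M' \<subseteq> mat_kernel ?M"
  proof
    fix v assume v: "v \<in> mat_kernel ?M'"
    then have "v \<in> carrier_vec (n + k)" by (rule mat_kernelD(1)[OF Mc'])
    then obtain x y where xy: "x \<in> carrier_vec n" "y \<in> carrier_vec k" "v = x @\<^sub>v y" by (rule vec_split_append)
    have "F *\<^sub>v x = 0\<^sub>v s" "y = 0\<^sub>v k" using mat_kernelD(2)[OF Mc' v] ker'[OF xy(1,2)] xy(3) by auto
    then have "?M *\<^sub>v v = 0\<^sub>v r + D' *\<^sub>v 0\<^sub>v k"
      unfolding xy(3) append_cols_mult_vec[OF D D' xy(1,2)] using FD[OF xy(1)] by simp
    also have "\<dots> = 0\<^sub>v r" using D' by (intro eq_vecI) auto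
    finally show "v \<in> mat_kernel ?M" using mat_kernelI[OF Mc \<open>v \<in> carrier_vec (n + k)\<close>] by blast
  qed
  have "vec_space.rank r ?M = n \<longleftrightarrow> mat_kernel ?M' = mat_kernel ?M"
    using rank_antimono_kernel(2)[OF Mc' Mc sub] unfolding rank' .
  also have "\<dots> \<longleftrightarrow> mat_kernel ?M \<subseteq> mat_kernel ?M'" using sub by blast
  also have "\<dots> \<longleftrightarrow> (\<forall>x\<in>carrier_vec n. \<forall>y\<in>carrier_vec k. D *\<^sub>v x + D' *\<^sub>v y = 0\<^sub>v r \<longrightarrow> F *\<^sub>v x = 0\<^sub>v s \<and> y = 0\<^sub>v k)"
  proof (intro iffI ballI impI subsetI)
    fix x y :: "'a vec" assume *: "mat_kernel ?M \<subseteq> mat_kernel ?M'" "x \<in> carrier_vec n" "y \<in> carrier_vec k" "D *\<^sub>v x + D' *\<^sub>v y = 0\<^sub>v r"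
    have "x @\<^sub>v y \<in> mat_kernel ?M"
      by (rule mat_kernelI[OF Mc append_carrier_vec[OF *(2,3)]]) (simp only: append_cols_mult_vec[OF D D' *(2,3)] *(4))
    then have "x @\<^sub>v y \<in> mat_kernel ?M'" using *(1) by blast
    then show "F *\<^sub>v x = 0\<^sub>v s \<and> y = 0\<^sub>v k" using mat_kernelD(2)[OF Mc'] ker'[OF *(2,3)] by blast
  next
    fix v assume *: "\<forall>x\<in>carrier_vec n. \<forall>y\<in>carrier_vec k. D *\<^sub>v x + D' *\<^sub>v y = 0\<^sub>v r \<longrightarrow> F *\<^sub>v x = 0\<^sub>v s \<and> y = 0\<^sub>v k"
      and v: "v \<in> mat_kernel ?M"
    have vc: "v \<in> carrier_vec (n + k)" by (rule mat_kernelD(1)[OF Mc v])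
    then obtain x y where xy: "x \<in> carrier_vec n" "y \<in> carrier_vec k" "v = x @\<^sub>v y" by (rule vec_split_append)
    have "D *\<^sub>v x + D' *\<^sub>v y = 0\<^sub>v r"
      using mat_kernelD(2)[OF Mc v] unfolding xy(3) append_cols_mult_vec[OF D D' xy(1,2)] .
    then have "?M' *\<^sub>v v = 0\<^sub>v (s + k)" unfolding xy(3) ker'[OF xy(1,2)] using * xy(1,2) by blast
    then show "v \<in> mat_kernel ?M'" by (rule mat_kernelI[OF Mc' vc])
  qed
  finally show ?thesis .
qed

section \<open>Splitting a complex matrix into an invertible and a nilpotent part\<close>

lemma similar_mat_swap_blocks:
  fixes A D :: "'a::comm_ring_1 mat"
  assumes A: "A \<in> carrier_mat n n" and D: "D \<in> carrier_mat m m"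
  shows "similar_mat (four_block_mat A (0\<^sub>m n m) (0\<^sub>m m n) D) (four_block_mat D (0\<^sub>m m n) (0\<^sub>m n m) A)"
proof -
  let ?P = "four_block_mat (0\<^sub>m n m) (1\<^sub>m n) (1\<^sub>m m) (0\<^sub>m m n) :: 'a mat"
  let ?Q = "four_block_mat (0\<^sub>m m n) (1\<^sub>m m) (1\<^sub>m n) (0\<^sub>m n m) :: 'a mat"
  let ?L = "four_block_mat A (0\<^sub>m n m) (0\<^sub>m m n) D"
  let ?R = "four_block_mat D (0\<^sub>m m n) (0\<^sub>m n m) A"
  have PQ: "?P * ?Q = 1\<^sub>m (n + m)"
    by (subst mult_four_block_mat[where ?nr1.0=n and ?nr2.0=m and ?n1.0=m and ?n2.0=n and ?nc1.0=n and ?nc2.0=m]) auto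
  have QP: "?Q * ?P = 1\<^sub>m (n + m)"
    by (subst mult_four_block_mat[where ?nr1.0=m and ?nr2.0=n and ?n1.0=n and ?n2.0=m and ?nc1.0=m and ?nc2.0=n])
      (auto simp: add.commute)
  have PR: "?P * ?R = four_block_mat (0\<^sub>m n m) A D (0\<^sub>m m n)"
    using A D by (subst mult_four_block_mat[where ?nr1.0=n and ?nr2.0=m and ?n1.0=m and ?n2.0=n and ?nc1.0=m and ?nc2.0=n]) auto
  have PRQ: "?L = ?P * ?R * ?Q"
    unfolding PR using A D
    by (subst mult_four_block_mat[where ?nr1.0=n and ?nr2.0=m and ?n1.0=m and ?n2.0=n and ?nc1.0=n and ?nc2.0=m]) auto
  have "similar_mat_wit ?L ?R ?P ?Q"
    by (rule similar_mat_witI[OF PQ QP PRQ]) (use A D in \<open>auto simp: add.commute\<close>)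
  then show ?thesis unfolding similar_mat_def by blast
qed

lemma jordan_matrix_similar_invertible_nilpotent:
  fixes n_as :: "(nat \<times> 'a::field) list"
  shows "\<exists>q p M1 M2. q + p = sum_list (map fst n_as) \<and> M1 \<in> carrier_mat q q \<and> M2 \<in> carrier_mat p p \<and>
    det M1 \<noteq> 0 \<and> (\<exists>i. M2 ^\<^sub>m i = 0\<^sub>m p p) \<and>
    similar_mat (jordan_matrix n_as) (four_block_mat M1 (0\<^sub>m q p) (0\<^sub>m p q) M2)"
proof (induction n_as)
  case Nil
  have "jordan_matrix [] = (0\<^sub>m 0 0 :: 'a mat)"
    by (intro eq_matI) auto
  moreover have "four_block_mat (0\<^sub>m 0 0) (0\<^sub>m 0 0) (0\<^sub>m 0 0) (0\<^sub>m 0 0) = (0\<^sub>m 0 0 :: 'a mat)"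
    by (intro eq_matI) auto
  moreover have "(0\<^sub>m 0 0 :: 'a mat) ^\<^sub>m 0 = 0\<^sub>m 0 0"
    by (intro eq_matI) auto
  ultimately show ?case
    by (intro exI[of _ 0] exI[of _ "0\<^sub>m 0 0"] conjI exI[of _ "0::nat"]) (auto intro!: similar_mat_refl)
next
  case (Cons na n_as)
  obtain n a where na: "na = (n, a)" by (cases na)
  let ?J = "jordan_block n a"
  have J: "?J \<in> carrier_mat n n" by simp
  from Cons obtain q p M1 M2 i where qp: "q + p = sum_list (map fst n_as)"
    and M1: "M1 \<in> carrier_mat q q" and M2: "M2 \<in> carrier_mat p p"
    and d: "det M1 \<noteq> 0" and nil: "M2 ^\<^sub>m i = 0\<^sub>m p p"
    and sim: "similar_mat (jordan_matrix n_as) (four_block_mat M1 (0\<^sub>m q p) (0\<^sub>m p q) M2)" (is "similar_mat _ ?D")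
    by blast
  have JM: "jordan_matrix n_as \<in> carrier_mat (q + p) (q + p)" using qp by (intro carrier_matI) auto
  have D: "?D \<in> carrier_mat (q + p) (q + p)" using M1 M2 by auto
  have sim1: "similar_mat (jordan_matrix (na # n_as)) (four_block_mat ?J (0\<^sub>m n (q + p)) (0\<^sub>m (q + p) n) ?D)"
    unfolding na jordan_matrix_Cons qp[symmetric]
    by (rule similar_mat_four_block_0_0[OF similar_mat_refl[OF J] sim J JM])
  \<comment> \<open>A block with \<open>a = 0\<close> has to be moved to the nilpotent part at the other end.\<close>
  show ?case
  proof (cases "a = 0")
    case False
    let ?M1 = "four_block_mat ?J (0\<^sub>m n q) (0\<^sub>m q n) M1"
    have eq: "four_block_mat ?J (0\<^sub>m n (q + p)) (0\<^sub>m (q + p) n) ?D = four_block_mat ?M1 (0\<^sub>m (n + q) p) (0\<^sub>m p (n + q)) M2"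
      using assoc_four_block_mat[of ?J M1 M2] M1 M2 by simp
    have dJ: "det ?J \<noteq> 0"
      using False by (subst det_upper_triangular[OF _ J]) (auto simp: diag_mat_def prod_list_zero_iff upper_triangular_def)
    have "det ?M1 = det ?J * det M1"
      by (rule det_four_block_mat_lower_left_zero[OF J _ _ M1]) auto
    then have "det ?M1 \<noteq> 0" using dJ d by simp
    moreover have "?M1 \<in> carrier_mat (n + q) (n + q)" using J M1 by (rule four_block_carrier_mat)
    moreover have "n + q + p = sum_list (map fst (na # n_as))" using qp na by simp
    ultimately show ?thesis using sim1[unfolded eq] M2 nil by blast
  next
    case True
    let ?M2 = "four_block_mat M2 (0\<^sub>m p n) (0\<^sub>m n p) ?J"
    have sim2: "similar_mat (four_block_mat ?J (0\<^sub>m n (q + p)) (0\<^sub>m (q + p) n) ?D)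
        (four_block_mat ?D (0\<^sub>m (q + p) n) (0\<^sub>m n (q + p)) ?J)"
      by (rule similar_mat_swap_blocks[OF J D])
    have eq: "four_block_mat ?D (0\<^sub>m (q + p) n) (0\<^sub>m n (q + p)) ?J = four_block_mat M1 (0\<^sub>m q (p + n)) (0\<^sub>m (p + n) q) ?M2"
      using assoc_four_block_mat[of M1 M2 ?J] M1 M2 by simp
    have "?M2 ^\<^sub>m (i + n) = four_block_mat (M2 ^\<^sub>m (i + n)) (0\<^sub>m p n) (0\<^sub>m n p) (?J ^\<^sub>m (i + n))"
      by (rule pow_four_block_mat[OF M2 J])
    also have "M2 ^\<^sub>m (i + n) = 0\<^sub>m p p"
    proof (induction n)
      case (Suc n) then show ?case using M2 by simp
    qed (use nil in simp)
    also have "?J ^\<^sub>m (i + n) = 0\<^sub>m n n"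
      unfolding True jordan_block_zero_pow by (intro eq_matI) auto
    also have "four_block_mat (0\<^sub>m p p) (0\<^sub>m p n) (0\<^sub>m n p) (0\<^sub>m n n) = (0\<^sub>m (p + n) (p + n) :: 'a mat)" by simp
    finally have "?M2 ^\<^sub>m (i + n) = 0\<^sub>m (p + n) (p + n)" .
    moreover have "?M2 \<in> carrier_mat (p + n) (p + n)" using M2 J by (rule four_block_carrier_mat)
    moreover have "q + (p + n) = sum_list (map fst (na # n_as))" using qp na by simp
    ultimately show ?thesis using similar_mat_trans[OF sim1 sim2, unfolded eq] M1 d by blast
  qed
qed

text \<open>
  Fitting decomposition: in the Jordan form, collect the blocks for nonzero eigenvalues in \<open>M1\<close>
  and those for the eigenvalue zero in \<open>M2\<close>.
\<close>

lemma similar_invertible_nilpotent: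
  fixes M :: "complex mat"
  assumes M: "M \<in> carrier_mat n n"
  shows "\<exists>q p M1 M2. q + p = n \<and> M1 \<in> carrier_mat q q \<and> M2 \<in> carrier_mat p p \<and>
    det M1 \<noteq> 0 \<and> (\<exists>i. M2 ^\<^sub>m i = 0\<^sub>m p p) \<and>
    similar_mat M (four_block_mat M1 (0\<^sub>m q p) (0\<^sub>m p q) M2)"
proof -
  obtain as where "char_poly M = (\<Prod>a\<leftarrow>as. [:- a, 1:])" using char_poly_factorized[OF M] by auto
  from jordan_nf_exists[OF M this] obtain n_as where sim: "similar_mat M (jordan_matrix n_as)"
    unfolding jordan_nf_def by auto
  obtain P Q where "similar_mat_wit M (jordan_matrix n_as) P Q"
    using sim unfolding similar_mat_def by blast
  from carrier_matD(1)[OF similar_mat_witD2(5)[OF M this]]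
  have n: "sum_list (map fst n_as) = n" unfolding jordan_matrix_dim .
  show ?thesis using jordan_matrix_similar_invertible_nilpotent[of n_as] similar_mat_trans[OF sim]
    unfolding n by blast
qed

section \<open>Weierstrass form and index\<close>

lemma mult_pencil_distrib:
  fixes e a :: "'a::comm_ring_1 mat"
  assumes e: "e \<in> carrier_mat n n" and a: "a \<in> carrier_mat n n"
    and X: "X \<in> carrier_mat n n" and Y: "Y \<in> carrier_mat n n"
  shows "X * (s \<cdot>\<^sub>m e - a) * Y = s \<cdot>\<^sub>m (X * e * Y) - X * a * Y"
  using X Y e a
  by (simp add: mult_minus_distrib_mat[of _ n n _ n] minus_mult_distrib_mat[of _ n n _ _ n]
      mult_smult_distrib[of _ n n _ n] mult_smult_assoc_mat[of _ n n _ n] del: assoc_mult_mat)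

text \<open>
  The Weierstrass form prescribes a matrix identity that is affine in \<open>s\<close>, so it amounts to one
  identity for the coefficient \<open>E\<close> and one for \<open>A\<close>.
\<close>

lemma pencil_block_diagonal_iff:
  fixes e a :: "complex mat"
  assumes e: "e \<in> carrier_mat n n" and a: "a \<in> carrier_mat n n"
    and X: "X \<in> carrier_mat n n" and Y: "Y \<in> carrier_mat n n"
    and J: "J \<in> carrier_mat q q" and N: "N \<in> carrier_mat p p" and n: "q + p = n"
  shows "(\<forall>s. X * (s \<cdot>\<^sub>m e - a) * Y =
           four_block_mat (s \<cdot>\<^sub>m 1\<^sub>m q - J) (0\<^sub>m q p) (0\<^sub>m p q) (s \<cdot>\<^sub>m N - 1\<^sub>m p)) \<longleftrightarrow>
         X * e * Y = four_block_mat (1\<^sub>m q) (0\<^sub>m q p) (0\<^sub>m p q) N \<and>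
         X * a * Y = four_block_mat J (0\<^sub>m q p) (0\<^sub>m p q) (1\<^sub>m p)" (is "(\<forall>s. ?L s = ?R s) \<longleftrightarrow> ?E = ?DE \<and> ?A = ?DA")
proof -
  have Ec: "?E \<in> carrier_mat n n" "?A \<in> carrier_mat n n" using X Y e a by auto
  have Dc: "?DE \<in> carrier_mat n n" "?DA \<in> carrier_mat n n" using J N n by auto
  have L: "?L s = s \<cdot>\<^sub>m ?E - ?A" for s
    by (rule mult_pencil_distrib[OF e a X Y])
  have R: "?R s = s \<cdot>\<^sub>m ?DE - ?DA" for s
    using J N by (intro eq_matI) auto
  show ?thesis
  proof
    assume "\<forall>s. ?L s = ?R s"
    then have eq: "s \<cdot>\<^sub>m ?E - ?A = s \<cdot>\<^sub>m ?DE - ?DA" for s unfolding L R by blast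
    have ent: "s * ?E $$ (i,j) - ?A $$ (i,j) = s * ?DE $$ (i,j) - ?DA $$ (i,j)" if "i < n" "j < n" for i j s
    proof -
      have "(s \<cdot>\<^sub>m ?E - ?A) $$ (i,j) = (s \<cdot>\<^sub>m ?DE - ?DA) $$ (i,j)" using eq by simp
      then show ?thesis using carrier_matD[OF Ec(1)] carrier_matD[OF Ec(2)] carrier_matD[OF Dc(1)] carrier_matD[OF Dc(2)] that
        by (simp del: index_mult_mat index_mat_four_block)
    qed
    have A: "?A $$ (i,j) = ?DA $$ (i,j)" if "i < n" "j < n" for i j
      using ent[OF that, of 0] by simp
    have E: "?E $$ (i,j) = ?DE $$ (i,j)" if "i < n" "j < n" for i j
      using ent[OF that, of 1] A[OF that] by simp
    show "?E = ?DE \<and> ?A = ?DA"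
      using carrier_matD[OF Ec(1)] carrier_matD[OF Ec(2)] carrier_matD[OF Dc(1)] carrier_matD[OF Dc(2)]
      by (intro conjI eq_matI) (simp_all add: A E del: index_mult_mat index_mat_four_block)
  next
    assume "?E = ?DE \<and> ?A = ?DA"
    then show "\<forall>s. ?L s = ?R s" unfolding L R by simp
  qed
qed

text \<open>
  A kernel vector satisfies \<open>v = c M v\<close>, hence \<open>v = (c M)\<^sup>k v\<close> for all \<open>k\<close>,
  and this vanishes for \<open>k = i\<close>.
\<close>

lemma invertible_one_minus_nilpotent:
  fixes M :: "'a::field mat"
  assumes M: "M \<in> carrier_mat p p" and nil: "M ^\<^sub>m i = 0\<^sub>m p p"
  shows "det (1\<^sub>m p - c \<cdot>\<^sub>m M) \<noteq> 0"
proof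
  assume "det (1\<^sub>m p - c \<cdot>\<^sub>m M) = 0"
  moreover have "1\<^sub>m p - c \<cdot>\<^sub>m M \<in> carrier_mat p p" using M by (intro minus_carrier_mat) auto
  ultimately obtain v where v: "v \<in> carrier_vec p" "v \<noteq> 0\<^sub>v p" "(1\<^sub>m p - c \<cdot>\<^sub>m M) *\<^sub>v v = 0\<^sub>v p"
    using det_0_iff_vec_prod_zero_field by blast
  have cM: "c \<cdot>\<^sub>m M \<in> carrier_mat p p" using M by auto
  have Mv: "M *\<^sub>v v \<in> carrier_vec p" using M v by auto
  have "v - c \<cdot>\<^sub>v (M *\<^sub>v v) = 0\<^sub>v p"
    using v(3) minus_mult_distrib_mat_vec[OF one_carrier_mat cM v(1)] v(1) M
    by (simp add: smult_mat_mult_vec)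
  then have vfix: "v = c \<cdot>\<^sub>v (M *\<^sub>v v)"
    using vec_minus_eq_0D[OF v(1), of "c \<cdot>\<^sub>v (M *\<^sub>v v)"] Mv by simp
  have "v = c ^ k \<cdot>\<^sub>v (M ^\<^sub>m k *\<^sub>v v)" for k
  proof (induction k)
    case (Suc k)
    have Mk: "M ^\<^sub>m k \<in> carrier_mat p p" using M by simp
    have "v = c ^ k \<cdot>\<^sub>v (M ^\<^sub>m k *\<^sub>v (c \<cdot>\<^sub>v (M *\<^sub>v v)))" using Suc vfix by simp
    also have "\<dots> = c ^ k \<cdot>\<^sub>v (c \<cdot>\<^sub>v (M ^\<^sub>m k *\<^sub>v (M *\<^sub>v v)))"
      by (simp add: mult_mat_vec[OF Mk Mv])
    also have "\<dots> = c ^ Suc k \<cdot>\<^sub>v (M ^\<^sub>m Suc k *\<^sub>v v)"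
      using assoc_mult_mat_vec[OF Mk M v(1)] by (simp add: smult_smult_assoc mult.commute)
    finally show ?case .
  qed (use v M in simp)
  moreover have "0\<^sub>m p p *\<^sub>v v = 0\<^sub>v p" using v(1) by (intro eq_vecI) auto
  ultimately have "v = c ^ i \<cdot>\<^sub>v 0\<^sub>v p" using nil by metis
  also have "\<dots> = 0\<^sub>v p" by (intro eq_vecI) auto
  finally have "v = 0\<^sub>v p" .
  with v show False by blast
qed

lemma pow_mat_mult_commute:
  fixes U M :: "'a::comm_ring_1 mat"
  assumes U: "U \<in> carrier_mat p p" and M: "M \<in> carrier_mat p p" and UM: "U * M = M * U"
  shows "(U * M) ^\<^sub>m i = U ^\<^sub>m i * M ^\<^sub>m i"
proof (induction i)
  case (Suc i)
  have Ui: "U ^\<^sub>m i \<in> carrier_mat p p" and Mi: "M ^\<^sub>m i \<in> carrier_mat p p" using U M by auto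
  have com: "M ^\<^sub>m i * U = U * M ^\<^sub>m i"
  proof (induction i)
    case (Suc i)
    have Mi: "M ^\<^sub>m i \<in> carrier_mat p p" using M by auto
    have "M ^\<^sub>m Suc i * U = M ^\<^sub>m i * (U * M)" using assoc_mult_mat[OF Mi M U] UM by simp
    also have "\<dots> = (U * M ^\<^sub>m i) * M" using assoc_mult_mat[OF Mi U M] Suc by simp
    finally show ?case using Mi M U by (simp add: assoc_mult_mat[of _ p p _ p _ p])
  qed (use U M in simp)
  have "(U * M) ^\<^sub>m Suc i = U ^\<^sub>m i * M ^\<^sub>m i * (U * M)" using Suc by simp
  also have "\<dots> = U ^\<^sub>m i * (M ^\<^sub>m i * (U * M))"
    by (rule assoc_mult_mat[OF Ui Mi mult_carrier_mat[OF U M]])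
  also have "M ^\<^sub>m i * (U * M) = U * (M ^\<^sub>m i * M)"
    using assoc_mult_mat[OF Mi U M] com assoc_mult_mat[OF U Mi M] by simp
  also have "U ^\<^sub>m i * (U * (M ^\<^sub>m i * M)) = U ^\<^sub>m i * U * (M ^\<^sub>m i * M)"
    by (rule assoc_mult_mat[OF Ui U mult_carrier_mat[OF Mi M], symmetric])
  finally show ?case by simp
qed (use U M in simp)

text \<open>
  Let \<open>T = \<alpha> E - \<beta> A\<close> be invertible and \<open>M = T\<^sup>-\<^sup>1 E\<close>. Then
  \<open>\<beta> T\<^sup>-\<^sup>1 A = \<alpha> M - I\<close> is a polynomial in \<open>M\<close>, so the Fitting decomposition of
  \<open>M\<close> block-diagonalises both coefficients at once, and scaling each block normalises it.
\<close>

lemma weierstrass_form_exists: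
  assumes E: "E \<in> carrier_mat n n" and A: "A \<in> carrier_mat n n" and reg: "regular_pencil E A"
  shows "\<exists>p N. weierstrass_form n E A p N"
proof -
  let ?e = "cmat E" and ?a = "cmat A"
  have e: "?e \<in> carrier_mat n n" and a: "?a \<in> carrier_mat n n" using E A by auto
  obtain \<alpha> \<beta> where det: "det (\<alpha> \<cdot>\<^sub>m ?e - \<beta> \<cdot>\<^sub>m ?a) \<noteq> 0" using reg unfolding regular_pencil_def by blast
  define T where "T = \<alpha> \<cdot>\<^sub>m ?e - \<beta> \<cdot>\<^sub>m ?a"
  have T: "T \<in> carrier_mat n n" unfolding T_def using e a by auto
  obtain T' where T': "T' \<in> carrier_mat n n" "T * T' = 1\<^sub>m n" "T' * T = 1\<^sub>m n"
    using obtain_inverse_mat[OF T] det unfolding T_def by blast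
  note asc = assoc_mult_mat[of _ n n _ n _ n]
  show ?thesis
  proof (cases "\<beta> = 0")
    case True
    have Te: "T = \<alpha> \<cdot>\<^sub>m ?e" unfolding T_def True using e a by (intro eq_matI) auto
    \<comment> \<open>Here \<open>E\<close> itself is invertible, so the nilpotent block is absent.\<close>
    let ?X = "\<alpha> \<cdot>\<^sub>m T'"
    have X: "?X \<in> carrier_mat n n" using T' by auto
    have Xe: "?X * ?e = 1\<^sub>m n" and eX: "?e * ?X = 1\<^sub>m n"
      using T'(2,3) T'(1) e unfolding Te
      by (simp_all add: mult_smult_distrib[of _ n n _ n] mult_smult_assoc_mat[of _ n n _ n])
    have Xa: "?X * ?a \<in> carrier_mat n n" using X a by auto
    have "?X * ?e * 1\<^sub>m n = four_block_mat (1\<^sub>m n) (0\<^sub>m n 0) (0\<^sub>m 0 n) (0\<^sub>m 0 0)"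
      unfolding Xe by (intro eq_matI) auto
    moreover have "?X * ?a * 1\<^sub>m n = four_block_mat (?X * ?a) (0\<^sub>m n 0) (0\<^sub>m 0 n) (1\<^sub>m 0)"
      using Xa by (intro eq_matI) auto
    ultimately have "\<forall>s. ?X * (s \<cdot>\<^sub>m ?e - ?a) * 1\<^sub>m n = four_block_mat (s \<cdot>\<^sub>m 1\<^sub>m n - ?X * ?a) (0\<^sub>m n 0) (0\<^sub>m 0 n) (s \<cdot>\<^sub>m 0\<^sub>m 0 0 - 1\<^sub>m 0)"
      using pencil_block_diagonal_iff[OF e a X one_carrier_mat Xa zero_carrier_mat[of 0 0]] by simp
    moreover have "invertible_mat ?X" using invertible_matI[OF X e Xe eX] .
    moreover have "invertible_mat (1\<^sub>m n :: complex mat)" by (rule invertible_matI[of _ n "1\<^sub>m n"]) auto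
    moreover have "(0\<^sub>m 0 0 :: complex mat) ^\<^sub>m 0 = 0\<^sub>m 0 0" by (intro eq_matI) auto
    ultimately have "weierstrass_form n E A 0 (0\<^sub>m 0 0)"
      unfolding weierstrass_form_def using X Xa
      by (metis add.right_neutral one_carrier_mat zero_carrier_mat)
    then show ?thesis by blast
  next
    case b: False
    define M where "M = T' * ?e"
    have M: "M \<in> carrier_mat n n" unfolding M_def using T' e by auto
    obtain q p M1 M2 i where qp: "q + p = n" and M1: "M1 \<in> carrier_mat q q" and M2: "M2 \<in> carrier_mat p p"
      and d: "det M1 \<noteq> 0" and nil: "M2 ^\<^sub>m i = 0\<^sub>m p p"
      and sim: "similar_mat M (four_block_mat M1 (0\<^sub>m q p) (0\<^sub>m p q) M2)" (is "similar_mat _ ?D")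
      using similar_invertible_nilpotent[OF M] by blast
    obtain P P' where w: "similar_mat_wit M ?D P P'" using sim unfolding similar_mat_def by blast
    note w = similar_mat_witD2[OF M w]
    obtain L where L: "L \<in> carrier_mat q q" "M1 * L = 1\<^sub>m q" "L * M1 = 1\<^sub>m q"
      using obtain_inverse_mat[OF M1 d] .
    let ?I = "1\<^sub>m p - \<alpha> \<cdot>\<^sub>m M2"
    have I: "?I \<in> carrier_mat p p" using M2 by auto
    obtain U where U: "U \<in> carrier_mat p p" "?I * U = 1\<^sub>m p" "U * ?I = 1\<^sub>m p"
      using obtain_inverse_mat[OF I invertible_one_minus_nilpotent[OF M2 nil]] .
    \<comment> \<open>\<open>L\<close> normalises the invertible block of \<open>E\<close> to the identity, \<open>V\<close> the
      nilpotent block of \<open>A\<close>: there \<open>A\<close> has become \<open>(\<alpha> M2 - I) / \<beta>\<close>.\<close>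
    define V where "V = (-\<beta>) \<cdot>\<^sub>m U"
    define N where "N = V * M2"
    define J where "J = (1 / \<beta>) \<cdot>\<^sub>m (\<alpha> \<cdot>\<^sub>m 1\<^sub>m q - L)"
    have V: "V \<in> carrier_mat p p" and N: "N \<in> carrier_mat p p" and J: "J \<in> carrier_mat q q"
      unfolding V_def N_def J_def using U M2 L by auto
    note ascp = assoc_mult_mat[of _ p p _ p _ p]
    have cI: "?I * M2 = M2 * ?I"
      using M2 by (simp add: minus_mult_distrib_mat[of _ p p _ _ p] mult_minus_distrib_mat[of _ p p _ p]
          mult_smult_distrib[of _ p p _ p] mult_smult_assoc_mat[of _ p p _ p])
    \<comment> \<open>The nilpotency of \<open>M2\<close> passes to \<open>V * M2\<close> because the two factors commute.\<close>
    have comm: "U * M2 = M2 * U"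
    proof -
      have "U * M2 = U * (M2 * ?I) * U"
        using U M2 I by (simp add: ascp)
      also have "\<dots> = M2 * U" unfolding cI[symmetric] using U M2 I by (simp add: ascp flip: assoc_mult_mat[of U p p ?I p])
      finally show ?thesis .
    qed
    have "V * M2 = M2 * V" unfolding V_def using U M2 comm
      by (simp add: mult_smult_distrib[of _ p p _ p] mult_smult_assoc_mat[of _ p p _ p])
    from pow_mat_mult_commute[OF V M2 this, of i] have nilN: "N ^\<^sub>m i = 0\<^sub>m p p"
      unfolding N_def nil using V by simp
    define Z where "Z = four_block_mat L (0\<^sub>m q p) (0\<^sub>m p q) V"
    have Z: "Z \<in> carrier_mat n n" unfolding Z_def using L V qp by auto
    define V' where "V' = (-1/\<beta>) \<cdot>\<^sub>m ?I"
    have V': "V' \<in> carrier_mat p p" unfolding V'_def using I by simp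
    define Z' where "Z' = four_block_mat M1 (0\<^sub>m q p) (0\<^sub>m p q) V'"
    have Z': "Z' \<in> carrier_mat n n" unfolding Z'_def using M1 V' qp by auto
    have VI: "V * V' = 1\<^sub>m p"
      unfolding V_def V'_def using U I b
      by (simp add: mult_smult_distrib[of _ p p _ p] mult_smult_assoc_mat[of _ p p _ p]) (intro eq_matI, auto)
    have ZZ': "Z * Z' = 1\<^sub>m n" unfolding Z_def Z'_def
      by (subst mult_four_block_mat[OF L(1) zero_carrier_mat zero_carrier_mat V M1 zero_carrier_mat zero_carrier_mat V'],
          unfold VI L(3)) (use L(1) V V' M1 qp in auto)
    have Z'Z: "Z' * Z = 1\<^sub>m n" 
      by (rule mat_mult_left_right_inverse[OF Z Z' ZZ'])
    let ?X = "Z * (P' * T')"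
    let ?X' = "T * (P * Z')"
    have X: "?X \<in> carrier_mat n n" and X': "?X' \<in> carrier_mat n n" using Z w(6,7) T' T Z' by auto
    have c1: "T' * (T * B) = B" "T * (T' * B) = B" "P * (P' * B) = B" "P' * (P * B) = B"
      "Z * (Z' * B) = B" "Z' * (Z * B) = B"
      if "B \<in> carrier_mat n n" for B
      by (rule mult_inverse_cancel_left[OF _ _ _ that]; use T T' w(1,2,6,7) Z Z' Z'Z ZZ' in blast)+
    have XX': "?X * ?X' = 1\<^sub>m n" "?X' * ?X = 1\<^sub>m n"
      using T T' w(1,2,6,7) Z Z' c1 ZZ' by (simp_all add: asc)
    have e_eq: "?e = T * M" unfolding M_def c1(2)[OF e] ..
    have XeP: "?X * ?e * P = four_block_mat (1\<^sub>m q) (0\<^sub>m q p) (0\<^sub>m p q) N"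
    proof -
      have D: "?D \<in> carrier_mat n n" by (rule w(5))
      have "?X * ?e * P = Z * ?D"
        unfolding e_eq w(3) using T T' w(1,2,6,7) Z c1 D right_mult_one_mat[OF D] by (simp add: asc)
      also have "\<dots> = four_block_mat (1\<^sub>m q) (0\<^sub>m q p) (0\<^sub>m p q) N"
        unfolding Z_def N_def using L V M1 M2
        by (subst mult_four_block_mat[OF L(1) _ _ V M1 _ _ M2]) auto
      finally show ?thesis .
    qed
    have a_eq: "?a = (1/\<beta>) \<cdot>\<^sub>m (\<alpha> \<cdot>\<^sub>m ?e - T)"
      unfolding T_def using b e a by (intro eq_matI) (auto simp: field_simps)
    have XTP: "?X * T * P = Z" using T T' w(1,2,6,7) Z c1 by (simp add: asc)
    have XaP: "?X * ?a * P = four_block_mat J (0\<^sub>m q p) (0\<^sub>m p q) (1\<^sub>m p)"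
    proof -
      have aT: "\<alpha> \<cdot>\<^sub>m ?e - T \<in> carrier_mat n n" using T by (rule minus_carrier_mat)
      have "?X * ?a * P = (1/\<beta>) \<cdot>\<^sub>m (\<alpha> \<cdot>\<^sub>m (?X * ?e * P) - ?X * T * P)"
        unfolding a_eq mult_pencil_distrib[OF e T X w(6), symmetric]
        using mult_smult_distrib[OF X aT] mult_smult_assoc_mat[OF mult_carrier_mat[OF X aT] w(6)] by simp
      also have "\<dots> = four_block_mat J (0\<^sub>m q p) (0\<^sub>m p q) ((1/\<beta>) \<cdot>\<^sub>m (\<alpha> \<cdot>\<^sub>m N - V))"
        unfolding XeP XTP unfolding Z_def J_def using L V N
        by (intro eq_matI) (auto simp del: index_mult_mat)
      also have "(1/\<beta>) \<cdot>\<^sub>m (\<alpha> \<cdot>\<^sub>m N - V) = 1\<^sub>m p"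
      proof -
        have "(1/\<beta>) \<cdot>\<^sub>m (\<alpha> \<cdot>\<^sub>m N - V) = U * ?I"
          unfolding N_def V_def using U(1) M2 b
          by (simp add: mult_minus_distrib_mat[of _ p p _ p] mult_smult_distrib[of _ p p _ p] mult_smult_assoc_mat[of _ p p _ p]) (intro eq_matI, auto simp: field_simps simp del: index_mult_mat(1))
        then show ?thesis using U by simp
      qed
      finally show ?thesis .
    qed
    have "\<forall>s. ?X * (s \<cdot>\<^sub>m ?e - ?a) * P = four_block_mat (s \<cdot>\<^sub>m 1\<^sub>m q - J) (0\<^sub>m q p) (0\<^sub>m p q) (s \<cdot>\<^sub>m N - 1\<^sub>m p)"
      using pencil_block_diagonal_iff[OF e a X w(6) J N qp] XeP XaP by blast
    moreover have "invertible_mat ?X" using invertible_matI[OF X X' XX'] .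
    moreover have "invertible_mat P" using invertible_matI[OF w(6,7,1,2)] .
    ultimately have "weierstrass_form n E A p N"
      unfolding weierstrass_form_def using N nilN J X w(6) qp by blast
    then show ?thesis by blast
  qed
qed

lemma cmat_mult_vec:
  assumes "M \<in> carrier_mat nr nc" "v \<in> carrier_vec nc"
  shows "cmat M *\<^sub>v map_vec complex_of_real v = map_vec complex_of_real (M *\<^sub>v v)"
  using assms by (intro eq_vecI) (auto simp: scalar_prod_def)

lemma cmat_mult_vec_Re_Im:
  assumes M: "M \<in> carrier_mat nr nc" and v: "v \<in> carrier_vec nc"
  shows "map_vec Re (cmat M *\<^sub>v v) = M *\<^sub>v map_vec Re v"
    and "map_vec Im (cmat M *\<^sub>v v) = M *\<^sub>v map_vec Im v"
  using assms by (intro eq_vecI; auto simp: scalar_prod_def)+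

text \<open>
  For regular pencils this is index at most one, expressed by vectors: \<open>A\<close> is injective
  on \<open>ker E\<close>, and the image meets the range of \<open>E\<close> only in zero. In this form the
  condition can be paired with \<open>Q z\<close>, which a complex normal form would not allow.
\<close>

definition separated_pencil :: "nat \<Rightarrow> 'a::field mat \<Rightarrow> 'a mat \<Rightarrow> bool" where
  "separated_pencil n E A \<longleftrightarrow> (\<forall>z\<in>carrier_vec n. \<forall>x\<in>carrier_vec n.
     E *\<^sub>v z = 0\<^sub>v n \<longrightarrow> A *\<^sub>v z = E *\<^sub>v x \<longrightarrow> z = 0\<^sub>v n)"

lemma separated_pencil_cmat_iff:
  assumes E: "E \<in> carrier_mat n n" and A: "A \<in> carrier_mat n n"
  shows "separated_pencil n (cmat E) (cmat A) \<longleftrightarrow> separated_pencil n E A"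
proof
  assume sep: "separated_pencil n (cmat E) (cmat A)"
  show "separated_pencil n E A" unfolding separated_pencil_def
  proof (intro ballI impI)
    fix z x assume z: "z \<in> carrier_vec n" "x \<in> carrier_vec n" and eq: "E *\<^sub>v z = 0\<^sub>v n" "A *\<^sub>v z = E *\<^sub>v x"
    have "map_vec complex_of_real z = 0\<^sub>v n"
      using sep[unfolded separated_pencil_def, rule_format, of "map_vec complex_of_real z" "map_vec complex_of_real x"]
        z eq cmat_mult_vec[OF E] cmat_mult_vec[OF A] by (auto simp: of_real_hom.vec_hom_zero)
    then have "complex_of_real (z $ i) = 0" if "i < n" for i
      using arg_cong[of _ _ "\<lambda>v. v $ i"] that z(1) by fastforce
    then show "z = 0\<^sub>v n" using z(1) by (intro eq_vecI) auto
  qed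
next
  assume sep: "separated_pencil n E A"
  show "separated_pencil n (cmat E) (cmat A)" unfolding separated_pencil_def
  proof (intro ballI impI)
    fix z x assume z: "z \<in> carrier_vec n" "x \<in> carrier_vec n"
      and eq: "cmat E *\<^sub>v z = 0\<^sub>v n" "cmat A *\<^sub>v z = cmat E *\<^sub>v x"
    have parts: "E *\<^sub>v map_vec Re z = 0\<^sub>v n" "E *\<^sub>v map_vec Im z = 0\<^sub>v n"
      "A *\<^sub>v map_vec Re z = E *\<^sub>v map_vec Re x" "A *\<^sub>v map_vec Im z = E *\<^sub>v map_vec Im x"
      unfolding cmat_mult_vec_Re_Im[OF E z(1), symmetric] cmat_mult_vec_Re_Im[OF A z(1), symmetric]
        cmat_mult_vec_Re_Im[OF E z(2), symmetric] eq
      by (intro eq_vecI; simp)+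
    have carr: "map_vec Re z \<in> carrier_vec n" "map_vec Im z \<in> carrier_vec n" 
      "map_vec Re x \<in> carrier_vec n" "map_vec Im x \<in> carrier_vec n" using z by auto
    have re: "map_vec Re z = 0\<^sub>v n" and im: "map_vec Im z = 0\<^sub>v n"
      using sep[unfolded separated_pencil_def, rule_format] carr parts by blast+
    have "Re (z $ i) = 0" "Im (z $ i) = 0" if "i < n" for i
      using arg_cong[OF re, of "\<lambda>v. v $ i"] arg_cong[OF im, of "\<lambda>v. v $ i"] that z by auto
    then show "z = 0\<^sub>v n" using z by (intro eq_vecI) (auto simp: complex_eq_iff)
  qed
qed

lemma weierstrass_form_blocks:
  assumes wf: "weierstrass_form n E A p N" and E: "E \<in> carrier_mat n n" and A: "A \<in> carrier_mat n n"
  obtains q J X Y X' Y' where "q + p = n" "J \<in> carrier_mat q q" "N \<in> carrier_mat p p"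
    "X \<in> carrier_mat n n" "Y \<in> carrier_mat n n" "X' \<in> carrier_mat n n" "Y' \<in> carrier_mat n n"
    "X' * X = 1\<^sub>m n" "Y * Y' = 1\<^sub>m n" "Y' * Y = 1\<^sub>m n"
    "X * cmat E * Y = four_block_mat (1\<^sub>m q) (0\<^sub>m q p) (0\<^sub>m p q) N"
    "X * cmat A * Y = four_block_mat J (0\<^sub>m q p) (0\<^sub>m p q) (1\<^sub>m p)"
proof -
  have c: "cmat E \<in> carrier_mat n n" "cmat A \<in> carrier_mat n n" using E A by auto
  obtain q J X Y where *: "N \<in> carrier_mat p p" "q + p = n" "J \<in> carrier_mat q q"
    "X \<in> carrier_mat n n" "Y \<in> carrier_mat n n" "invertible_mat X" "invertible_mat Y"
    "\<forall>s. X * (s \<cdot>\<^sub>m cmat E - cmat A) * Y =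
           four_block_mat (s \<cdot>\<^sub>m 1\<^sub>m q - J) (0\<^sub>m q p) (0\<^sub>m p q) (s \<cdot>\<^sub>m N - 1\<^sub>m p)"
    using wf unfolding weierstrass_form_def by blast
  obtain X' where X': "X' \<in> carrier_mat n n" "X' * X = 1\<^sub>m n" using invertible_matE[OF *(6,4)] by blast
  obtain Y' where Y': "Y' \<in> carrier_mat n n" "Y * Y' = 1\<^sub>m n" "Y' * Y = 1\<^sub>m n" using invertible_matE[OF *(7,5)] by blast
  from *(8) have "X * cmat E * Y = four_block_mat (1\<^sub>m q) (0\<^sub>m q p) (0\<^sub>m p q) N \<and>
    X * cmat A * Y = four_block_mat J (0\<^sub>m q p) (0\<^sub>m p q) (1\<^sub>m p)"
    using pencil_block_diagonal_iff[OF c *(4,5,3,1,2)] by blast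
  then show thesis using that * X' Y' by blast
qed

text \<open>
  Both sides describe the same obstruction, since \<open>ker E\<close> lives in the nilpotent block, where
  \<open>A\<close> is the identity and \<open>E\<close> is \<open>N\<close>.
\<close>

lemma weierstrass_form_separated_iff:
  assumes wf: "weierstrass_form n E A p N" and E: "E \<in> carrier_mat n n" and A: "A \<in> carrier_mat n n"
  shows "separated_pencil n E A \<longleftrightarrow> (\<forall>u\<in>carrier_vec p. \<forall>y\<in>carrier_vec p.
     N *\<^sub>v u = 0\<^sub>v p \<longrightarrow> u = N *\<^sub>v y \<longrightarrow> u = 0\<^sub>v p)"
proof -
  obtain q J X Y X' Y' where n: "q + p = n" and J: "J \<in> carrier_mat q q" and N: "N \<in> carrier_mat p p"
    and X: "X \<in> carrier_mat n n" and Y: "Y \<in> carrier_mat n n" and X': "X' \<in> carrier_mat n n" and Y': "Y' \<in> carrier_mat n n"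
    and X'X: "X' * X = 1\<^sub>m n" and YY': "Y * Y' = 1\<^sub>m n" and Y'Y: "Y' * Y = 1\<^sub>m n"
    and XE: "X * cmat E * Y = four_block_mat (1\<^sub>m q) (0\<^sub>m q p) (0\<^sub>m p q) N"
    and XA: "X * cmat A * Y = four_block_mat J (0\<^sub>m q p) (0\<^sub>m p q) (1\<^sub>m p)"
    by (rule weierstrass_form_blocks[OF wf E A])
  have e: "cmat E \<in> carrier_mat n n" and a: "cmat A \<in> carrier_mat n n" using E A by auto
  have E_eq: "X *\<^sub>v (cmat E *\<^sub>v (Y *\<^sub>v (v1 @\<^sub>v v2))) = v1 @\<^sub>v (N *\<^sub>v v2)"
    and A_eq: "X *\<^sub>v (cmat A *\<^sub>v (Y *\<^sub>v (v1 @\<^sub>v v2))) = (J *\<^sub>v v1) @\<^sub>v v2"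
    if v: "v1 \<in> carrier_vec q" "v2 \<in> carrier_vec p" for v1 v2
  proof -
    have c: "v1 @\<^sub>v v2 \<in> carrier_vec n" using v n by auto
    have XMY: "X *\<^sub>v (M *\<^sub>v (Y *\<^sub>v (v1 @\<^sub>v v2))) = (X * M * Y) *\<^sub>v (v1 @\<^sub>v v2)" if "M \<in> carrier_mat n n" for M
      using X Y c that by (simp add: assoc_mult_mat_vec[of _ n n _ n])
    show "X *\<^sub>v (cmat E *\<^sub>v (Y *\<^sub>v (v1 @\<^sub>v v2))) = v1 @\<^sub>v (N *\<^sub>v v2)"
      unfolding XMY[OF e] XE using mult_mat_vec_split[OF one_carrier_mat N v] v by simp
    show "X *\<^sub>v (cmat A *\<^sub>v (Y *\<^sub>v (v1 @\<^sub>v v2))) = (J *\<^sub>v v1) @\<^sub>v v2"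
      unfolding XMY[OF a] XA using mult_mat_vec_split[OF J one_carrier_mat v] v by simp
  qed
  have X_inj: "v = w" if "X *\<^sub>v v = X *\<^sub>v w" "v \<in> carrier_vec n" "w \<in> carrier_vec n" for v w
    using arg_cong[OF that(1), of "(*\<^sub>v) X'"] that(2,3) assoc_mult_mat_vec[OF X' X, symmetric] X'X by simp
  have X0: "X *\<^sub>v 0\<^sub>v n = 0\<^sub>v n" and Y0: "Y *\<^sub>v 0\<^sub>v n = 0\<^sub>v n" using mult_mat_zero_vec X Y by blast+
  have zero: "0\<^sub>v n = 0\<^sub>v q @\<^sub>v 0\<^sub>v p" using n by auto
  have split: "\<exists>v1\<in>carrier_vec q. \<exists>v2\<in>carrier_vec p. v = Y *\<^sub>v (v1 @\<^sub>v v2)" if "v \<in> carrier_vec n" for v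
  proof -
    have "Y' *\<^sub>v v \<in> carrier_vec (q + p)" using Y' that n by auto
    then have "Y' *\<^sub>v v = vec_first (Y' *\<^sub>v v) q @\<^sub>v vec_last (Y' *\<^sub>v v) p" by simp
    moreover have "v = Y *\<^sub>v (Y' *\<^sub>v v)" using assoc_mult_mat_vec[OF Y Y' that] YY' that by simp
    ultimately show ?thesis by (metis vec_first_carrier vec_last_carrier)
  qed
  show ?thesis unfolding separated_pencil_cmat_iff[OF E A, symmetric]
  proof (intro iffI ballI impI)
    fix u y assume sep: "separated_pencil n (cmat E) (cmat A)" and u: "u \<in> carrier_vec p" and y: "y \<in> carrier_vec p"
      and Nu: "N *\<^sub>v u = 0\<^sub>v p" and Ny: "u = N *\<^sub>v y"
    \<comment> \<open>Embed \<open>u\<close> and \<open>y\<close> into the nilpotent block.\<close>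
    let ?z = "Y *\<^sub>v (0\<^sub>v q @\<^sub>v u)" and ?x = "Y *\<^sub>v (0\<^sub>v q @\<^sub>v y)"
    have z: "?z \<in> carrier_vec n" "?x \<in> carrier_vec n" using Y u y n by auto
    have cE: "cmat E *\<^sub>v ?z \<in> carrier_vec n" "cmat A *\<^sub>v ?z \<in> carrier_vec n" "cmat E *\<^sub>v ?x \<in> carrier_vec n" using e a z by auto
    have "cmat E *\<^sub>v ?z = 0\<^sub>v n"
      by (rule X_inj[OF _ cE(1)]) (simp only: E_eq[OF zero_carrier_vec u] Nu X0 zero[symmetric], simp)
    moreover have "cmat A *\<^sub>v ?z = cmat E *\<^sub>v ?x"
      by (rule X_inj[OF _ cE(2,3)]) (use A_eq[OF _ u, of "0\<^sub>v q"] E_eq[OF _ y, of "0\<^sub>v q"] Ny J in auto)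
    ultimately have "?z = 0\<^sub>v n" using sep z unfolding separated_pencil_def by blast
    moreover have "cmat A *\<^sub>v 0\<^sub>v n = 0\<^sub>v n" using a by (intro eq_vecI) auto
    ultimately have "X *\<^sub>v (cmat A *\<^sub>v ?z) = 0\<^sub>v n" using X0 by simp
    moreover have "J *\<^sub>v 0\<^sub>v q = 0\<^sub>v q" using J by (intro eq_vecI) auto
    ultimately have "0\<^sub>v q @\<^sub>v u = 0\<^sub>v q @\<^sub>v 0\<^sub>v p" using A_eq[OF zero_carrier_vec u] zero by metis
    then show "u = 0\<^sub>v p" using append_vec_eq[of "0\<^sub>v q" q "0\<^sub>v q"] by auto
  next
    assume inj: "\<forall>u\<in>carrier_vec p. \<forall>y\<in>carrier_vec p. N *\<^sub>v u = 0\<^sub>v p \<longrightarrow> u = N *\<^sub>v y \<longrightarrow> u = 0\<^sub>v p"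
    show "separated_pencil n (cmat E) (cmat A)" unfolding separated_pencil_def
    proof (intro ballI impI)
      fix z x assume z: "z \<in> carrier_vec n" and x: "x \<in> carrier_vec n"
        and Ez: "cmat E *\<^sub>v z = 0\<^sub>v n" and Az: "cmat A *\<^sub>v z = cmat E *\<^sub>v x"
      obtain z1 z2 where z12: "z1 \<in> carrier_vec q" "z2 \<in> carrier_vec p" "z = Y *\<^sub>v (z1 @\<^sub>v z2)" using split[OF z] by blast
      obtain x1 x2 where x12: "x1 \<in> carrier_vec q" "x2 \<in> carrier_vec p" "x = Y *\<^sub>v (x1 @\<^sub>v x2)" using split[OF x] by blast
      have "z1 @\<^sub>v (N *\<^sub>v z2) = 0\<^sub>v q @\<^sub>v 0\<^sub>v p"
        using E_eq[OF z12(1,2)] unfolding z12(3)[symmetric] Ez X0 unfolding zero by (rule sym)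
      then have "z1 = 0\<^sub>v q" "N *\<^sub>v z2 = 0\<^sub>v p" using append_vec_eq[OF z12(1), of "0\<^sub>v q"] by auto
      moreover have "(J *\<^sub>v z1) @\<^sub>v z2 = x1 @\<^sub>v (N *\<^sub>v x2)"
        using A_eq[OF z12(1,2)] E_eq[OF x12(1,2)] Az unfolding z12(3)[symmetric] x12(3)[symmetric] by simp
      then have "z2 = N *\<^sub>v x2" using append_vec_eq[of "J *\<^sub>v z1" q x1] J z12(1) x12(1) by auto
      ultimately have "z1 = 0\<^sub>v q" "z2 = 0\<^sub>v p" using inj z12(2) x12(2) by blast+
      then have "z1 @\<^sub>v z2 = 0\<^sub>v n" unfolding zero by (rule arg_cong2)
      then show "z = 0\<^sub>v n" unfolding z12(3) using Y0 by simp
    qed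
  qed
qed

text \<open>
  If \<open>N\<close> is nilpotent but nonzero, a last nonvanishing vector \<open>N\<^sup>k v\<close> with \<open>k > 0\<close>
  lies in both the kernel and the range of \<open>N\<close>.
\<close>

lemma nilpotent_mat_zero_iff:
  fixes N :: "'a::field mat"
  assumes N: "N \<in> carrier_mat p p" and nil: "N ^\<^sub>m i = 0\<^sub>m p p"
  shows "N = 0\<^sub>m p p \<longleftrightarrow> (\<forall>u\<in>carrier_vec p. \<forall>y\<in>carrier_vec p. N *\<^sub>v u = 0\<^sub>v p \<longrightarrow> u = N *\<^sub>v y \<longrightarrow> u = 0\<^sub>v p)"
proof (intro iffI)
  assume "N = 0\<^sub>m p p"
  then show "\<forall>u\<in>carrier_vec p. \<forall>y\<in>carrier_vec p. N *\<^sub>v u = 0\<^sub>v p \<longrightarrow> u = N *\<^sub>v y \<longrightarrow> u = 0\<^sub>v p"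
    by (auto simp: zero_mat_mult_vec)
next
  assume inj: "\<forall>u\<in>carrier_vec p. \<forall>y\<in>carrier_vec p. N *\<^sub>v u = 0\<^sub>v p \<longrightarrow> u = N *\<^sub>v y \<longrightarrow> u = 0\<^sub>v p"
  have step: "N *\<^sub>v v = 0\<^sub>v p" if "v \<in> carrier_vec p" "N *\<^sub>v (N *\<^sub>v v) = 0\<^sub>v p" for v
    using inj that N mult_mat_vec_carrier[OF N that(1)] by blast
  have "N *\<^sub>v v = 0\<^sub>v p" if "v \<in> carrier_vec p" "N ^\<^sub>m k *\<^sub>v v = 0\<^sub>v p" for k v
    using that
  proof (induction k arbitrary: v)
    case 0 then show ?case using N by auto
  next
    case (Suc k)
    have "N ^\<^sub>m k *\<^sub>v (N *\<^sub>v v) = 0\<^sub>v p"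
      using Suc.prems assoc_mult_mat_vec[OF pow_carrier_mat[OF N] N Suc.prems(1), of k] by simp
    then have "N *\<^sub>v (N *\<^sub>v v) = 0\<^sub>v p"
      by (rule Suc.IH[OF mult_mat_vec_carrier[OF N Suc.prems(1)]])
    then show ?case by (rule step[OF Suc.prems(1)])
  qed
  then have Nv: "N *\<^sub>v v = 0\<^sub>v p" if "v \<in> carrier_vec p" for v
    using that nil zero_mat_mult_vec[OF that, of p] by metis
  show "N = 0\<^sub>m p p"
  proof (rule eq_matI)
    fix i j assume "i < dim_row (0\<^sub>m p p)" "j < dim_col (0\<^sub>m p p)"
    then have ij: "i < p" "j < p" by auto
    have "N $$ (i,j) = (N *\<^sub>v unit_vec p j) $ i" using N ij by (simp add: scalar_prod_right_unit)
    then show "N $$ (i,j) = 0\<^sub>m p p $$ (i,j)" using Nv[of "unit_vec p j"] ij by simp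
  qed (use N in auto)
qed

lemma nilpotency_degree_le_1_iff:
  assumes N: "N \<in> carrier_mat p p" and nil: "\<exists>i. N ^\<^sub>m i = 0\<^sub>m p p"
  shows "nilpotency_degree N \<le> 1 \<longleftrightarrow> N = 0\<^sub>m p p"
proof
  have d: "nilpotency_degree N = (LEAST i. N ^\<^sub>m i = 0\<^sub>m p p)" using N unfolding nilpotency_degree_def by simp
  have N1: "N ^\<^sub>m 1 = N" using N by simp
  show "N = 0\<^sub>m p p" if "nilpotency_degree N \<le> 1"
  proof -
    have z: "N ^\<^sub>m nilpotency_degree N = 0\<^sub>m p p" unfolding d using nil by (rule LeastI_ex)
    show ?thesis
    proof (cases "nilpotency_degree N = 0")
      case True
      then have one: "1\<^sub>m p = (0\<^sub>m p p :: complex mat)" using z N by simp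
      have "N = 1\<^sub>m p * N" using N by simp
      also have "\<dots> = 0\<^sub>m p p" unfolding one using N by simp
      finally show ?thesis .
    next
      case False
      then have "nilpotency_degree N = 1" using that by simp
      then show ?thesis using z N1 by simp
    qed
  qed
  show "nilpotency_degree N \<le> 1" if "N = 0\<^sub>m p p"
    unfolding d using N1 that by (intro Least_le) simp
qed

theorem pencil_index_le_1_iff:
  assumes E: "E \<in> carrier_mat n n" and A: "A \<in> carrier_mat n n" and reg: "regular_pencil E A"
  shows "pencil_index E A \<le> 1 \<longleftrightarrow> separated_pencil n E A"
proof -
  have deg: "nilpotency_degree N \<le> 1 \<longleftrightarrow> separated_pencil n E A" if wf: "weierstrass_form n E A p N" for p N
  proof -
    have N: "N \<in> carrier_mat p p" and nil: "\<exists>i. N ^\<^sub>m i = 0\<^sub>m p p" using wf unfolding weierstrass_form_def by auto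
    show ?thesis
      using nilpotency_degree_le_1_iff[OF N nil] nilpotent_mat_zero_iff[OF N] nil
        weierstrass_form_separated_iff[OF wf E A] by blast
  qed
  let ?P = "\<lambda>\<nu>. \<exists>p N. weierstrass_form n E A p N \<and> nilpotency_degree N = \<nu>"
  have ind: "pencil_index E A = (LEAST \<nu>. ?P \<nu>)" unfolding pencil_index_def using E by simp
  \<comment> \<open>Existence matters: only a nonempty set gives its \<open>LEAST\<close> element a meaning.\<close>
  have "\<exists>\<nu>. ?P \<nu>" using weierstrass_form_exists[OF E A reg] by blast
  then have "?P (pencil_index E A)" unfolding ind by (rule LeastI_ex)
  then obtain p N where "weierstrass_form n E A p N" "nilpotency_degree N = pencil_index E A" by blast
  then show ?thesis using deg by metis
qed

lemma regular_pencil_if_det_minus: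
  assumes E: "E \<in> carrier_mat n n" and A: "A \<in> carrier_mat n n" and det: "det (E - A) \<noteq> 0"
  shows "regular_pencil E A"
proof -
  have "1 \<cdot>\<^sub>m cmat E - 1 \<cdot>\<^sub>m cmat A = cmat (E - A)" using E A by (intro eq_matI) auto
  then have "det (1 \<cdot>\<^sub>m cmat E - 1 \<cdot>\<^sub>m cmat A) \<noteq> 0" using det by (simp add: of_real_hom.hom_det)
  then show ?thesis unfolding regular_pencil_def by blast
qed

section \<open>Port-Hamiltonian systems\<close>

text \<open>
  A nonnegative quadratic form that vanishes at \<open>x\<close> has a minimum there, so its derivative in
  the direction \<open>y = M x\<close>, which is \<open>2 (y \<bullet> y)\<close>, must vanish.
\<close>

lemma pos_semidef_scalar_prod_eq_0D:
  assumes psd: "pos_semidef M" and M: "M \<in> carrier_mat n n" and x: "x \<in> carrier_vec n"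
    and zero: "x \<bullet> (M *\<^sub>v x) = 0"
  shows "M *\<^sub>v x = 0\<^sub>v n"
proof -
  define y where "y = M *\<^sub>v x"
  have y: "y \<in> carrier_vec n" unfolding y_def using M x by simp
  have My: "M *\<^sub>v y \<in> carrier_vec n" using M y by simp
  have sym: "x \<bullet> (M *\<^sub>v y) = y \<bullet> y"
    using transpose_vec_mult_scalar[OF M y x] psd unfolding pos_semidef_def y_def by simp
  define a b where "a = y \<bullet> y" and "b = y \<bullet> (M *\<^sub>v y)"
  have b: "b \<ge> 0" using psd M y unfolding pos_semidef_def b_def by simp
  have quad: "0 \<le> 2 * t * a + t * t * b" for t
  proof -
    have ty: "t \<cdot>\<^sub>v y \<in> carrier_vec n" using y by simp
    have "M *\<^sub>v (x + t \<cdot>\<^sub>v y) = y + t \<cdot>\<^sub>v (M *\<^sub>v y)"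
      using mult_add_distrib_mat_vec[OF M x ty] mult_mat_vec[OF M y] unfolding y_def by simp
    then have "(x + t \<cdot>\<^sub>v y) \<bullet> (M *\<^sub>v (x + t \<cdot>\<^sub>v y)) = x \<bullet> y + t * (x \<bullet> (M *\<^sub>v y)) + (t * (y \<bullet> y) + t * (t * (y \<bullet> (M *\<^sub>v y))))"
      using x y My ty
      by (simp add: add_scalar_prod_distrib[of _ n] scalar_prod_add_distrib[of _ n])
    moreover have "x + t \<cdot>\<^sub>v y \<in> carrier_vec (dim_row M)" using x y M by simp
    ultimately show ?thesis
      using psd zero sym unfolding pos_semidef_def a_def b_def y_def[symmetric] by (auto simp: algebra_simps)
  qed
  have "a = 0"
  proof (rule ccontr)
    assume "a \<noteq> 0"
    \<comment> \<open>Minimising over \<open>t\<close> suggests \<open>- a / b\<close>; adding 1 to \<open>b\<close> covers \<open>b = 0\<close> as well.\<close>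
    define t where "t = - a / (b + 1)"
    have t: "t * (b + 1) = - a" using b unfolding t_def by simp
    have "(2 * t * a + t * t * b) * (b + 1)\<^sup>2 = 2 * a * (t * (b + 1)) * (b + 1) + (t * (b + 1)) * (t * (b + 1)) * b"
      by (simp add: power2_eq_square algebra_simps)
    also have "\<dots> = - (a\<^sup>2 * (b + 2))" unfolding t by (simp add: power2_eq_square algebra_simps)
    also have "\<dots> < 0" using b \<open>a \<noteq> 0\<close> by (simp add: zero_less_mult_iff)
    finally have "(2 * t * a + t * t * b) * (b + 1)\<^sup>2 < 0" .
    then show False using quad[of t] by (simp add: mult_less_0_iff)
  qed
  then show ?thesis using scalar_prod_self_eq_0_iff[OF y] unfolding a_def y_def by simp
qed

text \<open>
  Because of \<open>Q\<^sup>T P = 0\<close>, input and output are adjoint with respect to \<open>Q\<close>.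
\<close>

lemma port_hamiltonian_transpose_Q:
  fixes B C Q G P :: "real mat"
  assumes BC: "B = G - P" "C = (G + P)\<^sup>T * Q" "Q\<^sup>T * P = 0\<^sub>m n m"
    and c: "Q \<in> carrier_mat n n" "G \<in> carrier_mat n m" "P \<in> carrier_mat n m"
  shows "Q\<^sup>T * B = C\<^sup>T"
proof -
  have Qt: "Q\<^sup>T \<in> carrier_mat n n" using c by simp
  have "Q\<^sup>T * B = Q\<^sup>T * G - Q\<^sup>T * P" unfolding BC(1) by (rule mult_minus_distrib_mat[OF Qt c(2,3)])
  moreover have "C\<^sup>T = Q\<^sup>T * (G + P)" unfolding BC(2) using c by (subst transpose_mult[of _ m n]) auto
  moreover have "Q\<^sup>T * (G + P) = Q\<^sup>T * G + Q\<^sup>T * P" by (rule mult_add_distrib_mat[OF Qt c(2,3)])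
  ultimately show ?thesis unfolding BC(3) using c by (intro eq_matI) auto
qed

text \<open>
  The port-Hamiltonian equations as properties of bilinear forms, with \<open>J, R, G, P\<close>
  eliminated: \<open>Q x \<bullet> E y\<close> is the energy form, and \<open>- (Q x \<bullet> A x)\<close> is the
  dissipated power. The two conditions on null vectors come from the fact that a semidefinite form
  vanishing at \<open>x\<close> vanishes at all pairs \<open>(x, y)\<close>; what is left of \<open>A\<close> is the
  skew part \<open>J\<close>.
\<close>

locale dissipative_form =
  fixes n m :: nat and E A B C Q :: "real mat"
  assumes Q_carrier: "Q \<in> carrier_mat n n"
    and B_adjoint: "\<And>x v. x \<in> carrier_vec n \<Longrightarrow> v \<in> carrier_vec m \<Longrightarrow>
      (Q *\<^sub>v x) \<bullet> (B *\<^sub>v v) = (C *\<^sub>v x) \<bullet> v"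
    and E_sym: "\<And>x y. x \<in> carrier_vec n \<Longrightarrow> y \<in> carrier_vec n \<Longrightarrow>
      (Q *\<^sub>v x) \<bullet> (E *\<^sub>v y) = (Q *\<^sub>v y) \<bullet> (E *\<^sub>v x)"
    and E_nonneg: "\<And>x. x \<in> carrier_vec n \<Longrightarrow> (Q *\<^sub>v x) \<bullet> (E *\<^sub>v x) \<ge> 0"
    and E_null: "\<And>x y. x \<in> carrier_vec n \<Longrightarrow> y \<in> carrier_vec n \<Longrightarrow>
      (Q *\<^sub>v x) \<bullet> (E *\<^sub>v x) = 0 \<Longrightarrow> (Q *\<^sub>v x) \<bullet> (E *\<^sub>v y) = 0"
    and A_nonpos: "\<And>x. x \<in> carrier_vec n \<Longrightarrow> (Q *\<^sub>v x) \<bullet> (A *\<^sub>v x) \<le> 0"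
    and A_skew_on_null: "\<And>x y. x \<in> carrier_vec n \<Longrightarrow> y \<in> carrier_vec n \<Longrightarrow>
      (Q *\<^sub>v x) \<bullet> (A *\<^sub>v x) = 0 \<Longrightarrow> (Q *\<^sub>v x) \<bullet> (A *\<^sub>v y) = - ((Q *\<^sub>v y) \<bullet> (A *\<^sub>v x))"
    and ker_Q: "\<And>x. x \<in> carrier_vec n \<Longrightarrow> Q *\<^sub>v x = 0\<^sub>v n \<Longrightarrow> A *\<^sub>v x = 0\<^sub>v n"

lemma port_hamiltonian_imp_dissipative_form:
  assumes ph: "port_hamiltonian n m E A B C"
  shows "\<exists>Q. dissipative_form n m E A B C Q"
proof -
  from ph obtain J R Q G P where E: "E \<in> carrier_mat n n" and A: "A \<in> carrier_mat n n"
    and B: "B \<in> carrier_mat n m" and C: "C \<in> carrier_mat m n"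
    and J: "J \<in> carrier_mat n n" and R: "R \<in> carrier_mat n n" and Q: "Q \<in> carrier_mat n n"
    and G: "G \<in> carrier_mat n m" and P: "P \<in> carrier_mat n m"
    and skew: "J = - J\<^sup>T" and A_eq: "A = (J - R) * Q" and BC: "B = G - P" "C = (G + P)\<^sup>T * Q"
    and symE: "Q\<^sup>T * E = E\<^sup>T * Q" and psdE: "pos_semidef (Q\<^sup>T * E)"
    and symR: "Q\<^sup>T * R * Q = Q\<^sup>T * R\<^sup>T * Q" and psdR: "pos_semidef (Q\<^sup>T * R * Q)" and QP: "Q\<^sup>T * P = 0\<^sub>m n m"
    unfolding port_hamiltonian_def by blast
  have QB: "Q\<^sup>T * B = C\<^sup>T" by (rule port_hamiltonian_transpose_Q[OF BC QP Q G P])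
  have Qt: "Q\<^sup>T \<in> carrier_mat n n" using Q by simp
  have move: "(Q *\<^sub>v x) \<bullet> v = x \<bullet> (Q\<^sup>T *\<^sub>v v)" if "x \<in> carrier_vec n" "v \<in> carrier_vec n" for x v
    using transpose_vec_mult_scalar[OF Qt that(2,1)] by simp
  have psd_form: "x \<bullet> (M *\<^sub>v y) = y \<bullet> (M *\<^sub>v x)" "x \<bullet> (M *\<^sub>v x) \<ge> 0"
      "x \<bullet> (M *\<^sub>v x) = 0 \<Longrightarrow> x \<bullet> (M *\<^sub>v y) = 0"
    if M: "M \<in> carrier_mat n n" and psd: "pos_semidef M" and x: "x \<in> carrier_vec n" and y: "y \<in> carrier_vec n" for M x y
  proof -
    show sym: "x \<bullet> (M *\<^sub>v y) = y \<bullet> (M *\<^sub>v x)"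
      using transpose_vec_mult_scalar[OF M y x] psd M x y unfolding pos_semidef_def
      by (simp add: comm_scalar_prod[of _ n])
    show "x \<bullet> (M *\<^sub>v x) \<ge> 0" using psd M x unfolding pos_semidef_def by simp
    show "x \<bullet> (M *\<^sub>v y) = 0" if "x \<bullet> (M *\<^sub>v x) = 0"
      unfolding sym pos_semidef_scalar_prod_eq_0D[OF psd M x that] using y by simp
  qed
  have QE: "Q\<^sup>T * E \<in> carrier_mat n n" and QRQ: "Q\<^sup>T * R * Q \<in> carrier_mat n n" using Q E R by auto
  have formE: "(Q *\<^sub>v x) \<bullet> (E *\<^sub>v y) = x \<bullet> ((Q\<^sup>T * E) *\<^sub>v y)" if "x \<in> carrier_vec n" "y \<in> carrier_vec n" for x y
    using move[OF that(1), of "E *\<^sub>v y"] assoc_mult_mat_vec[OF Qt E that(2)] E that by simp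
  have formR: "(Q *\<^sub>v x) \<bullet> (R *\<^sub>v (Q *\<^sub>v y)) = x \<bullet> ((Q\<^sup>T * R * Q) *\<^sub>v y)" if "x \<in> carrier_vec n" "y \<in> carrier_vec n" for x y
    using move[OF that(1), of "R *\<^sub>v (Q *\<^sub>v y)"] Q R Qt that by (simp add: assoc_mult_mat_vec[of _ n n _ n])
  have Jskew: "a \<bullet> (J *\<^sub>v b) = - (b \<bullet> (J *\<^sub>v a))" if "a \<in> carrier_vec n" "b \<in> carrier_vec n" for a b
  proof -
    have "a \<bullet> (J *\<^sub>v b) = (J\<^sup>T *\<^sub>v a) \<bullet> b" using transpose_vec_mult_scalar[OF J that(2,1)] by simp
    also have "J\<^sup>T = - J" using arg_cong[OF skew, of uminus] J by (simp add: uminus_uminus_mat)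
    also have "- J *\<^sub>v a = - (J *\<^sub>v a)" using J that by (intro eq_vecI) auto
    also have "(- (J *\<^sub>v a)) \<bullet> b = - (b \<bullet> (J *\<^sub>v a))"
      using J that by (simp add: comm_scalar_prod[of _ n])
    finally show ?thesis .
  qed
  have A_vec: "A *\<^sub>v y = J *\<^sub>v (Q *\<^sub>v y) - R *\<^sub>v (Q *\<^sub>v y)" if "y \<in> carrier_vec n" for y
    unfolding A_eq assoc_mult_mat_vec[OF minus_carrier_mat[OF R] Q that]
    by (rule minus_mult_distrib_mat_vec[OF J R mult_mat_vec_carrier[OF Q that]])
  have formA: "(Q *\<^sub>v x) \<bullet> (A *\<^sub>v y) = (Q *\<^sub>v x) \<bullet> (J *\<^sub>v (Q *\<^sub>v y)) - x \<bullet> ((Q\<^sup>T * R * Q) *\<^sub>v y)"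
    if "x \<in> carrier_vec n" "y \<in> carrier_vec n" for x y
    unfolding A_vec[OF that(2)] formR[OF that, symmetric] using J R Q that
    by (simp add: scalar_prod_minus_distrib[of _ n])
  have Qv: "Q *\<^sub>v x \<in> carrier_vec n" if "x \<in> carrier_vec n" for x using Q that by simp
  have formA_self: "(Q *\<^sub>v x) \<bullet> (A *\<^sub>v x) = - (x \<bullet> ((Q\<^sup>T * R * Q) *\<^sub>v x))" if "x \<in> carrier_vec n" for x
    using formA[OF that that] Jskew[OF Qv[OF that] Qv[OF that]] by simp
  have "dissipative_form n m E A B C Q"
  proof (rule dissipative_form.intro[OF Q])
    show "(Q *\<^sub>v x) \<bullet> (B *\<^sub>v v) = (C *\<^sub>v x) \<bullet> v" if "x \<in> carrier_vec n" "v \<in> carrier_vec m" for x v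
    proof -
      have "(Q *\<^sub>v x) \<bullet> (B *\<^sub>v v) = x \<bullet> ((Q\<^sup>T * B) *\<^sub>v v)"
        using move[OF that(1), of "B *\<^sub>v v"] assoc_mult_mat_vec[OF Qt B that(2)] B that by simp
      also have "\<dots> = (C *\<^sub>v x) \<bullet> v" unfolding QB using transpose_vec_mult_scalar[of "C\<^sup>T" n m v x] C that by simp
      finally show ?thesis .
    qed
    show "(Q *\<^sub>v x) \<bullet> (E *\<^sub>v y) = (Q *\<^sub>v y) \<bullet> (E *\<^sub>v x)" if "x \<in> carrier_vec n" "y \<in> carrier_vec n" for x y
      unfolding formE[OF that] formE[OF that(2,1)] by (rule psd_form(1)[OF QE psdE that])
    show "(Q *\<^sub>v x) \<bullet> (E *\<^sub>v x) \<ge> 0" if "x \<in> carrier_vec n" for x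
      unfolding formE[OF that that] by (rule psd_form(2)[OF QE psdE that that])
    show "(Q *\<^sub>v x) \<bullet> (E *\<^sub>v y) = 0" if "x \<in> carrier_vec n" "y \<in> carrier_vec n" "(Q *\<^sub>v x) \<bullet> (E *\<^sub>v x) = 0" for x y
      using psd_form(3)[OF QE psdE that(1,2)] that(3) unfolding formE[OF that(1,1)] formE[OF that(1,2)] .
    show "(Q *\<^sub>v x) \<bullet> (A *\<^sub>v x) \<le> 0" if "x \<in> carrier_vec n" for x
      unfolding formA_self[OF that] using psd_form(2)[OF QRQ psdR that that] by simp
    show "(Q *\<^sub>v x) \<bullet> (A *\<^sub>v y) = - ((Q *\<^sub>v y) \<bullet> (A *\<^sub>v x))"
      if "x \<in> carrier_vec n" "y \<in> carrier_vec n" "(Q *\<^sub>v x) \<bullet> (A *\<^sub>v x) = 0" for x y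
    proof -
      have "x \<bullet> ((Q\<^sup>T * R * Q) *\<^sub>v y) = 0"
        using psd_form(3)[OF QRQ psdR that(1,2)] that(3) unfolding formA_self[OF that(1)] by simp
      moreover from this have "y \<bullet> ((Q\<^sup>T * R * Q) *\<^sub>v x) = 0" using psd_form(1)[OF QRQ psdR that(1,2)] by simp
      ultimately show ?thesis
        unfolding formA[OF that(1,2)] formA[OF that(2,1)] using Jskew[OF Qv[OF that(1)] Qv[OF that(2)]] by simp
    qed
    show "A *\<^sub>v x = 0\<^sub>v n" if "x \<in> carrier_vec n" "Q *\<^sub>v x = 0\<^sub>v n" for x
      unfolding A_vec[OF that(1)] that(2) mult_mat_zero_vec[OF J] mult_mat_zero_vec[OF R] by simp
  qed
  then show ?thesis by blast
qed

text \<open>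
  The feedback changes \<open>Q\<^sup>T E\<close> by \<open>Q\<^sup>T B K C = C\<^sup>T K C\<close>, which is
  positive semidefinite together with \<open>K\<close>.
\<close>

lemma port_hamiltonian_output_feedback:
  assumes ph: "port_hamiltonian n m E A B C" and K: "K \<in> carrier_mat m m" and psdK: "pos_semidef K"
  shows "port_hamiltonian n m (E + B * K * C) A B C"
proof -
  from ph obtain J R Q G P where E: "E \<in> carrier_mat n n" and A: "A \<in> carrier_mat n n"
    and B: "B \<in> carrier_mat n m" and C: "C \<in> carrier_mat m n"
    and JRQGP: "J \<in> carrier_mat n n" "R \<in> carrier_mat n n" "Q \<in> carrier_mat n n"
      "G \<in> carrier_mat n m" "P \<in> carrier_mat n m"
    and eqs: "J = - J\<^sup>T" "A = (J - R) * Q" and BC: "B = G - P" "C = (G + P)\<^sup>T * Q"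
    and symE: "Q\<^sup>T * E = E\<^sup>T * Q" and psdE: "pos_semidef (Q\<^sup>T * E)"
    and R: "Q\<^sup>T * R * Q = Q\<^sup>T * R\<^sup>T * Q" "pos_semidef (Q\<^sup>T * R * Q)" and QP: "Q\<^sup>T * P = 0\<^sub>m n m"
    unfolding port_hamiltonian_def by blast
  note Q = JRQGP(3)
  have QB: "Q\<^sup>T * B = C\<^sup>T" by (rule port_hamiltonian_transpose_Q[OF BC QP JRQGP(3-5)])
  have Qt: "Q\<^sup>T \<in> carrier_mat n n" and Ct: "C\<^sup>T \<in> carrier_mat n m" using Q C by auto
  have KC: "K * C \<in> carrier_mat m n" and CKC: "C\<^sup>T * (K * C) \<in> carrier_mat n n" and QE: "Q\<^sup>T * E \<in> carrier_mat n n"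
    using K C E Q by auto
  have BKC: "B * K * C = B * (K * C)" by (rule assoc_mult_mat[OF B K C])
  have BKCc: "B * (K * C) \<in> carrier_mat n n" using B KC by auto
  \<comment> \<open>The witnesses \<open>J, R, Q, G, P\<close> are kept; only the conditions on \<open>Q\<^sup>T E\<close> change.\<close>
  have eq: "Q\<^sup>T * (E + B * K * C) = Q\<^sup>T * E + C\<^sup>T * (K * C)"
    unfolding BKC mult_add_distrib_mat[OF Qt E BKCc] assoc_mult_mat[OF Qt B KC, symmetric] QB ..
  have Kt: "K\<^sup>T = K" using psdK unfolding pos_semidef_def by blast
  have CKCt: "(C\<^sup>T * (K * C))\<^sup>T = C\<^sup>T * (K * C)"
    unfolding transpose_mult[OF Ct KC] transpose_mult[OF K C] Kt Matrix.transpose_transpose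
    by (rule assoc_mult_mat[OF Ct K C])
  have QEt: "(Q\<^sup>T * E)\<^sup>T = Q\<^sup>T * E" using psdE unfolding pos_semidef_def by blast
  have sym: "(Q\<^sup>T * (E + B * K * C))\<^sup>T = Q\<^sup>T * (E + B * K * C)"
    unfolding eq transpose_add[OF QE CKC] CKCt QEt ..
  have "pos_semidef (Q\<^sup>T * (E + B * K * C))"
    unfolding pos_semidef_def
  proof (intro conjI ballI sym)
    fix x :: "real vec" assume "x \<in> carrier_vec (dim_row (Q\<^sup>T * (E + B * K * C)))"
    then have x: "x \<in> carrier_vec n" using Q by simp
    have Cx: "C *\<^sub>v x \<in> carrier_vec m" using C x by simp
    have "x \<bullet> ((C\<^sup>T * (K * C)) *\<^sub>v x) = x \<bullet> (C\<^sup>T *\<^sub>v (K *\<^sub>v (C *\<^sub>v x)))"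
      using assoc_mult_mat_vec[OF Ct KC x] assoc_mult_mat_vec[OF K C x] by simp
    also have "\<dots> = (C *\<^sub>v x) \<bullet> (K *\<^sub>v (C *\<^sub>v x))"
      using transpose_vec_mult_scalar[OF Ct _ x, of "K *\<^sub>v (C *\<^sub>v x)"] K Cx
        comm_scalar_prod[of x n "C\<^sup>T *\<^sub>v (K *\<^sub>v (C *\<^sub>v x))"] x Ct comm_scalar_prod[OF Cx, of "K *\<^sub>v (C *\<^sub>v x)"]
        transpose_vec_mult_scalar[OF C x, of "K *\<^sub>v (C *\<^sub>v x)"]
      by simp
    also have "\<dots> \<ge> 0" using psdK K Cx unfolding pos_semidef_def by simp
    finally have "x \<bullet> ((C\<^sup>T * (K * C)) *\<^sub>v x) \<ge> 0" .
    moreover have "x \<bullet> ((Q\<^sup>T * E) *\<^sub>v x) \<ge> 0" using psdE Q x unfolding pos_semidef_def by simp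
    moreover have "x \<bullet> ((Q\<^sup>T * E + C\<^sup>T * (K * C)) *\<^sub>v x) = x \<bullet> ((Q\<^sup>T * E) *\<^sub>v x) + x \<bullet> ((C\<^sup>T * (K * C)) *\<^sub>v x)"
      unfolding add_mult_distrib_mat_vec[OF QE CKC x]
      by (rule scalar_prod_add_distrib[OF x mult_mat_vec_carrier[OF QE x] mult_mat_vec_carrier[OF CKC x]])
    ultimately show "x \<bullet> (Q\<^sup>T * (E + B * K * C) *\<^sub>v x) \<ge> 0" unfolding eq by simp
  qed
  moreover have EE: "E + B * K * C \<in> carrier_mat n n" unfolding BKC using E BKCc by simp
  moreover have "Q\<^sup>T * (E + B * K * C) = (E + B * K * C)\<^sup>T * Q"
    using sym transpose_mult[OF Qt EE] by simp
  ultimately show ?thesis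
    unfolding port_hamiltonian_def
    by (intro conjI bexI[of _ J] bexI[of _ R] bexI[of _ Q] bexI[of _ G] bexI[of _ P]
        A B C JRQGP eqs BC R QP)
qed

lemma pos_semidef_one: "pos_semidef (1\<^sub>m m)"
  unfolding pos_semidef_def using scalar_prod_self_nonneg by auto

section \<open>Output feedback with maximal rank\<close>

lemma feedback_mult_vec:
  fixes E B K C :: "'a::comm_ring_1 mat"
  assumes "E \<in> carrier_mat n n" "B \<in> carrier_mat n m" "K \<in> carrier_mat m m" "C \<in> carrier_mat m n" "x \<in> carrier_vec n"
  shows "(E + B * K * C) *\<^sub>v x = E *\<^sub>v x + B *\<^sub>v (K *\<^sub>v (C *\<^sub>v x))"
  using add_mult_distrib_mat_vec[OF assms(1) mult_carrier_mat[OF mult_carrier_mat[OF assms(2,3)] assms(4)] assms(5)]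
    assoc_mult_mat_vec[OF mult_carrier_mat[OF assms(2,3)] assms(4,5)]
    assoc_mult_mat_vec[OF assms(2,3) mult_mat_vec_carrier[OF assms(4,5)]] by simp

text \<open>
  Pairing with \<open>Q x\<close> gives \<open>Q x \<bullet> E x + C x \<bullet> C x = 0\<close>, a sum of two nonnegative
  terms. Hence the kernel of \<open>E + B C\<close> is as small as any feedback permits.
\<close>

lemma port_hamiltonian_kernel_unit_feedback:
  assumes ph: "port_hamiltonian n m E A B C" and x: "x \<in> carrier_vec n"
    and zero: "E *\<^sub>v x + B *\<^sub>v (C *\<^sub>v x) = 0\<^sub>v n"
  shows "E *\<^sub>v x = 0\<^sub>v n" and "C *\<^sub>v x = 0\<^sub>v m"
proof -
  have E: "E \<in> carrier_mat n n" and B: "B \<in> carrier_mat n m" and C: "C \<in> carrier_mat m n"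
    using ph unfolding port_hamiltonian_def by blast+
  obtain Q where "dissipative_form n m E A B C Q" using port_hamiltonian_imp_dissipative_form[OF ph] by blast
  then interpret dissipative_form n m E A B C Q .
  have c: "Q *\<^sub>v x \<in> carrier_vec n" "E *\<^sub>v x \<in> carrier_vec n" "C *\<^sub>v x \<in> carrier_vec m" "B *\<^sub>v (C *\<^sub>v x) \<in> carrier_vec n"
    using Q_carrier E B C x by auto
  have "0 = (Q *\<^sub>v x) \<bullet> (E *\<^sub>v x + B *\<^sub>v (C *\<^sub>v x))" unfolding zero using c by simp
  also have "\<dots> = (Q *\<^sub>v x) \<bullet> (E *\<^sub>v x) + (C *\<^sub>v x) \<bullet> (C *\<^sub>v x)"
    unfolding scalar_prod_add_distrib[OF c(1,2,4)] B_adjoint[OF x c(3)] ..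
  finally have "(C *\<^sub>v x) \<bullet> (C *\<^sub>v x) = 0"
    using E_nonneg[OF x] scalar_prod_self_nonneg[of "C *\<^sub>v x"] by linarith
  then show Cx: "C *\<^sub>v x = 0\<^sub>v m" using scalar_prod_self_eq_0_iff[OF c(3)] by blast
  show "E *\<^sub>v x = 0\<^sub>v n" using zero c(2) unfolding Cx mult_mat_zero_vec[OF B] by simp
qed

lemma max_feedback_rank:
  assumes ph: "port_hamiltonian n m E A B C"
  shows "Max ((\<lambda>K. mat_rank (E + B * K * C)) ` carrier_mat m m) = vec_space.rank (n + m) (E @\<^sub>r C)"
    and "mat_rank (E + B * 1\<^sub>m m * C) = vec_space.rank (n + m) (E @\<^sub>r C)"
proof -
  have E: "E \<in> carrier_mat n n" and B: "B \<in> carrier_mat n m" and C: "C \<in> carrier_mat m n"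
    using ph unfolding port_hamiltonian_def by blast+
  have F: "E @\<^sub>r C \<in> carrier_mat (n + m) n" using E C by simp
  have EK: "E + B * K * C \<in> carrier_mat n n" if "K \<in> carrier_mat m m" for K
    using E mult_carrier_mat[OF mult_carrier_mat[OF B that] C] by simp
  have row: "dim_row (E + B * K * C) = n" for K using B by simp
  have sub: "mat_kernel (E @\<^sub>r C) \<subseteq> mat_kernel (E + B * K * C)" if K: "K \<in> carrier_mat m m" for K
  proof
    fix x assume "x \<in> mat_kernel (E @\<^sub>r C)"
    note x = mat_kernelD[OF F this]
    have "E *\<^sub>v x = 0\<^sub>v n" "C *\<^sub>v x = 0\<^sub>v m" using x(2) append_rows_mult_vec_eq_0_iff[OF E C x(1)] by blast+
    then have "(E + B * K * C) *\<^sub>v x = 0\<^sub>v n"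
      unfolding feedback_mult_vec[OF E B K C x(1)] by (simp add: mult_mat_zero_vec[OF K] mult_mat_zero_vec[OF B])
    then show "x \<in> mat_kernel (E + B * K * C)" by (rule mat_kernelI[OF EK[OF K] x(1)])
  qed
  have le: "mat_rank (E + B * K * C) \<le> vec_space.rank (n + m) (E @\<^sub>r C)" if "K \<in> carrier_mat m m" for K
    unfolding row by (rule rank_antimono_kernel(1)[OF F EK[OF that] sub[OF that]])
  have "mat_kernel (E + B * 1\<^sub>m m * C) \<subseteq> mat_kernel (E @\<^sub>r C)"
  proof
    fix x assume "x \<in> mat_kernel (E + B * 1\<^sub>m m * C)"
    note x = mat_kernelD[OF EK[OF one_carrier_mat] this]
    have "C *\<^sub>v x \<in> carrier_vec m" using C x(1) by simp
    then have "E *\<^sub>v x + B *\<^sub>v (C *\<^sub>v x) = 0\<^sub>v n"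
      using x(2) unfolding feedback_mult_vec[OF E B one_carrier_mat C x(1)] by simp
    then have "(E @\<^sub>r C) *\<^sub>v x = 0\<^sub>v (n + m)"
      using port_hamiltonian_kernel_unit_feedback[OF ph x(1)] append_rows_mult_vec_eq_0_iff[OF E C x(1)] by blast
    then show "x \<in> mat_kernel (E @\<^sub>r C)" by (rule mat_kernelI[OF F x(1)])
  qed
  then have "mat_kernel (E @\<^sub>r C) = mat_kernel (E + B * 1\<^sub>m m * C)" using sub[OF one_carrier_mat] by blast
  then show one: "mat_rank (E + B * 1\<^sub>m m * C) = vec_space.rank (n + m) (E @\<^sub>r C)"
    unfolding row using rank_antimono_kernel(2)[OF F EK[OF one_carrier_mat] sub[OF one_carrier_mat]] by blast
  show "Max ((\<lambda>K. mat_rank (E + B * K * C)) ` carrier_mat m m) = vec_space.rank (n + m) (E @\<^sub>r C)"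
  proof (rule Max_eqI)
    show "finite ((\<lambda>K. mat_rank (E + B * K * C)) ` carrier_mat m m)"
      by (rule finite_subset[OF _ finite_atMost[of "vec_space.rank (n + m) (E @\<^sub>r C)"]]) (use le in blast)
    show "r \<le> vec_space.rank (n + m) (E @\<^sub>r C)" if "r \<in> (\<lambda>K. mat_rank (E + B * K * C)) ` carrier_mat m m" for r
      using that le by blast
    show "vec_space.rank (n + m) (E @\<^sub>r C) \<in> (\<lambda>K. mat_rank (E + B * K * C)) ` carrier_mat m m"
      by (rule image_eqI[where x = "1\<^sub>m m"], rule one[symmetric], rule one_carrier_mat)
  qed
qed

section \<open>The two rank conditions\<close>

lemma rank_feedback_block_iff:
  fixes E A C S :: "'a::field mat"
  assumes E: "E \<in> carrier_mat n n" and A: "A \<in> carrier_mat n n" and C: "C \<in> carrier_mat m n"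
    and S: "right_null_basis (E @\<^sub>r C) S"
  shows "mat_rank (four_block_mat E (A * S) C (0\<^sub>m m (dim_col S))) = n \<longleftrightarrow>
    (\<forall>z\<in>carrier_vec n. \<forall>x\<in>carrier_vec n. E *\<^sub>v z = 0\<^sub>v n \<longrightarrow> C *\<^sub>v z = 0\<^sub>v m \<longrightarrow> C *\<^sub>v x = 0\<^sub>v m \<longrightarrow>
       A *\<^sub>v z = E *\<^sub>v x \<longrightarrow> z = 0\<^sub>v n)" (is "_ \<longleftrightarrow> ?R")
proof -
  define k where "k = dim_col S"
  let ?F = "E @\<^sub>r C" and ?D = "(A * S) @\<^sub>r 0\<^sub>m m k"
  have F: "?F \<in> carrier_mat (n + m) n" using E C by simp
  note Sd = right_null_basisD[OF S F k_def]
  have AS: "A * S \<in> carrier_mat n k" using A Sd(1) by simp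
  have D: "?D \<in> carrier_mat (n + m) k" using AS by simp
  have blk: "four_block_mat E (A * S) C (0\<^sub>m m (dim_col S)) = append_cols ?F ?D"
    unfolding k_def[symmetric] by (rule four_block_mat_eq_append_cols[OF E AS C])
  have row: "dim_row (append_cols ?F ?D) = n + m" using append_cols_carrier[OF F D] by simp
  have Dy: "?F *\<^sub>v x + ?D *\<^sub>v y = (E *\<^sub>v x + A *\<^sub>v (S *\<^sub>v y)) @\<^sub>v (C *\<^sub>v x)" if "x \<in> carrier_vec n" "y \<in> carrier_vec k" for x y
    unfolding mat_mult_append[OF E C that(1)] mat_mult_append[OF AS zero_carrier_mat that(2)]
      assoc_mult_mat_vec[OF A Sd(1) that(2)] zero_mat_mult_vec[OF that(2)]
    using E A C Sd(1) that by (intro eq_vecI) auto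
  have "0\<^sub>v (n + m) = 0\<^sub>v n @\<^sub>v (0\<^sub>v m :: 'a vec)" by auto
  then have Dy0: "?F *\<^sub>v x + ?D *\<^sub>v y = 0\<^sub>v (n + m) \<longleftrightarrow> E *\<^sub>v x + A *\<^sub>v (S *\<^sub>v y) = 0\<^sub>v n \<and> C *\<^sub>v x = 0\<^sub>v m"
    if "x \<in> carrier_vec n" "y \<in> carrier_vec k" for x y
    unfolding Dy[OF that] using append_vec_eq[of "E *\<^sub>v x + A *\<^sub>v (S *\<^sub>v y)" n "0\<^sub>v n"] E A Sd(1) that by simp
  have F0: "?F *\<^sub>v x = 0\<^sub>v (n + m) \<longleftrightarrow> E *\<^sub>v x = 0\<^sub>v n \<and> C *\<^sub>v x = 0\<^sub>v m" if "x \<in> carrier_vec n" for x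
    by (rule append_rows_mult_vec_eq_0_iff[OF E C that])
  note neg = mult_mat_uminus_vec and move = mult_vec_add_eq_0_iff[OF E A]
  have "mat_rank (four_block_mat E (A * S) C (0\<^sub>m m (dim_col S))) = n \<longleftrightarrow>
    (\<forall>x\<in>carrier_vec n. \<forall>y\<in>carrier_vec k. E *\<^sub>v x + A *\<^sub>v (S *\<^sub>v y) = 0\<^sub>v n \<and> C *\<^sub>v x = 0\<^sub>v m \<longrightarrow>
       (E *\<^sub>v x = 0\<^sub>v n \<and> C *\<^sub>v x = 0\<^sub>v m) \<and> y = 0\<^sub>v k)"
    unfolding blk row using rank_append_cols_eq_iff[OF F F D S k_def] F0 Dy0 by simp
  also have "\<dots> \<longleftrightarrow> ?R"
  proof (intro iffI ballI impI)
    fix z x assume *: "\<forall>x\<in>carrier_vec n. \<forall>y\<in>carrier_vec k. E *\<^sub>v x + A *\<^sub>v (S *\<^sub>v y) = 0\<^sub>v n \<and> C *\<^sub>v x = 0\<^sub>v m \<longrightarrow>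
       (E *\<^sub>v x = 0\<^sub>v n \<and> C *\<^sub>v x = 0\<^sub>v m) \<and> y = 0\<^sub>v k"
      and zx: "z \<in> carrier_vec n" "x \<in> carrier_vec n" and eqs: "E *\<^sub>v z = 0\<^sub>v n" "C *\<^sub>v z = 0\<^sub>v m" "C *\<^sub>v x = 0\<^sub>v m" "A *\<^sub>v z = E *\<^sub>v x"
    obtain y where y: "y \<in> carrier_vec k" "z = S *\<^sub>v y" using Sd(3)[OF zx(1)] F0[OF zx(1)] eqs by blast
    have "E *\<^sub>v (- x) + A *\<^sub>v (S *\<^sub>v y) = 0\<^sub>v n" using move[of "- x" z] zx eqs(4) y(2) by simp
    moreover have "C *\<^sub>v (- x) = 0\<^sub>v m" using neg[OF C zx(2)] eqs(3) by simp
    moreover have "- x \<in> carrier_vec n" using zx by simp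
    ultimately have "y = 0\<^sub>v k" using * y(1) by blast
    then show "z = 0\<^sub>v n" unfolding y(2) using Sd(1) by (intro eq_vecI) auto
  next
    fix x y assume *: ?R and xy: "x \<in> carrier_vec n" "y \<in> carrier_vec k"
      and eqs: "E *\<^sub>v x + A *\<^sub>v (S *\<^sub>v y) = 0\<^sub>v n \<and> C *\<^sub>v x = 0\<^sub>v m"
    let ?z = "S *\<^sub>v y"
    have z: "?z \<in> carrier_vec n" using Sd(1) xy by simp
    have "E *\<^sub>v ?z = 0\<^sub>v n" "C *\<^sub>v ?z = 0\<^sub>v m" using F0[OF z] Sd(2)[OF xy(2)] by auto
    moreover have "A *\<^sub>v ?z = E *\<^sub>v (- x)" using move[OF xy(1) z] eqs by blast
    moreover have "C *\<^sub>v (- x) = 0\<^sub>v m" using neg[OF C xy(1)] eqs by simp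
    moreover have "- x \<in> carrier_vec n" using xy by simp
    ultimately have z0: "?z = 0\<^sub>v n" using * z by blast
    have A0: "A *\<^sub>v 0\<^sub>v n = 0\<^sub>v n" using A by (intro eq_vecI) auto
    have "E *\<^sub>v x = 0\<^sub>v n" using eqs E xy unfolding z0 A0 by simp
    then show "(E *\<^sub>v x = 0\<^sub>v n \<and> C *\<^sub>v x = 0\<^sub>v m) \<and> y = 0\<^sub>v k" using eqs Sd(4)[OF xy(2) z0] by blast
  qed
  finally show ?thesis .
qed

lemma rank_triple_block_iff:
  fixes E A B S :: "'a::field mat"
  assumes E: "E \<in> carrier_mat n n" and A: "A \<in> carrier_mat n n" and B: "B \<in> carrier_mat n m" and S: "S \<in> carrier_mat n k"
  shows "mat_rank (append_cols (append_cols E (A * S)) B) = n \<longleftrightarrow>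
    (\<forall>w\<in>carrier_vec n. \<exists>x\<in>carrier_vec n. \<exists>y\<in>carrier_vec k. \<exists>v\<in>carrier_vec m.
       w = E *\<^sub>v x + A *\<^sub>v (S *\<^sub>v y) + B *\<^sub>v v)" (is "_ \<longleftrightarrow> ?R")
proof -
  have AS: "A * S \<in> carrier_mat n k" using A S by simp
  let ?D = "append_cols E (A * S)"
  have D: "?D \<in> carrier_mat n (n + k)" by (rule append_cols_carrier[OF E AS])
  have M: "append_cols ?D B \<in> carrier_mat n (n + k + m)" by (rule append_cols_carrier[OF D B])
  have row: "dim_row (append_cols ?D B) = n" using M by simp
  have eq: "append_cols ?D B *\<^sub>v ((x @\<^sub>v y) @\<^sub>v v) = E *\<^sub>v x + A *\<^sub>v (S *\<^sub>v y) + B *\<^sub>v v"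
    if "x \<in> carrier_vec n" "y \<in> carrier_vec k" "v \<in> carrier_vec m" for x y v
    unfolding append_cols_mult_vec[OF D B append_carrier_vec[OF that(1,2)] that(3)]
      append_cols_mult_vec[OF E AS that(1,2)] assoc_mult_mat_vec[OF A S that(2)] ..
  have "(\<exists>u\<in>carrier_vec (n + k + m). append_cols ?D B *\<^sub>v u = w) \<longleftrightarrow>
    (\<exists>x\<in>carrier_vec n. \<exists>y\<in>carrier_vec k. \<exists>v\<in>carrier_vec m. w = E *\<^sub>v x + A *\<^sub>v (S *\<^sub>v y) + B *\<^sub>v v)" for w
  proof
    assume "\<exists>u\<in>carrier_vec (n + k + m). append_cols ?D B *\<^sub>v u = w"
    then obtain u where u: "u \<in> carrier_vec (n + k + m)" "append_cols ?D B *\<^sub>v u = w" by blast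
    obtain xy v where 1: "xy \<in> carrier_vec (n + k)" "v \<in> carrier_vec m" "u = xy @\<^sub>v v" using u(1) by (rule vec_split_append)
    obtain x y where 2: "x \<in> carrier_vec n" "y \<in> carrier_vec k" "xy = x @\<^sub>v y" using 1(1) by (rule vec_split_append)
    show "\<exists>x\<in>carrier_vec n. \<exists>y\<in>carrier_vec k. \<exists>v\<in>carrier_vec m. w = E *\<^sub>v x + A *\<^sub>v (S *\<^sub>v y) + B *\<^sub>v v"
      using u(2) eq[OF 2(1,2) 1(2)] 1(2,3) 2 by blast
  next
    assume "\<exists>x\<in>carrier_vec n. \<exists>y\<in>carrier_vec k. \<exists>v\<in>carrier_vec m. w = E *\<^sub>v x + A *\<^sub>v (S *\<^sub>v y) + B *\<^sub>v v"
    then obtain x y v where xyv: "x \<in> carrier_vec n" "y \<in> carrier_vec k" "v \<in> carrier_vec m" "w = E *\<^sub>v x + A *\<^sub>v (S *\<^sub>v y) + B *\<^sub>v v" by blast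
    show "\<exists>u\<in>carrier_vec (n + k + m). append_cols ?D B *\<^sub>v u = w"
      by (rule bexI[of _ "(x @\<^sub>v y) @\<^sub>v v"]) (use xyv eq[OF xyv(1-3)] in auto)
  qed
  then show ?thesis unfolding row rank_eq_dim_row_iff_surj[OF M] by blast
qed

text \<open>
  Maximality of the rank means that \<open>ker (E + B K C)\<close> is the common kernel of \<open>E\<close> and
  \<open>C\<close>, which is spanned by \<open>S\<close>. Index at most one then makes \<open>[E + B K C, A S]\<close>
  have rank \<open>n\<close>. The columns of \<open>E + B K C\<close> are combinations of those of \<open>E\<close> and
  \<open>B\<close>, which gives the second condition; on vectors with \<open>C x = 0\<close> feedback does nothing,
  which gives the first.
\<close>

lemma feedback_rank_conditions_necessary:
  fixes E A B C K S :: "real mat"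
  assumes E: "E \<in> carrier_mat n n" and A: "A \<in> carrier_mat n n" and B: "B \<in> carrier_mat n m"
    and C: "C \<in> carrier_mat m n" and K: "K \<in> carrier_mat m m"
    and S: "right_null_basis (E @\<^sub>r C) S"
    and sep: "separated_pencil n (E + B * K * C) A"
    and rank: "mat_rank (E + B * K * C) = vec_space.rank (n + m) (E @\<^sub>r C)"
  shows "mat_rank (four_block_mat E (A * S) C (0\<^sub>m m (dim_col S))) = n"
    and "mat_rank (append_cols (append_cols E (A * S)) B) = n"
proof -
  let ?F = "E @\<^sub>r C" and ?E = "E + B * K * C"
  define k where "k = dim_col S"
  have F: "?F \<in> carrier_mat (n + m) n" using E C by simp
  have EK: "?E \<in> carrier_mat n n" using E mult_carrier_mat[OF mult_carrier_mat[OF B K] C] by simp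
  note Sd = right_null_basisD[OF S F k_def]
  note fb = feedback_mult_vec[OF E B K C]
  have F0: "?F *\<^sub>v x = 0\<^sub>v (n + m) \<longleftrightarrow> E *\<^sub>v x = 0\<^sub>v n \<and> C *\<^sub>v x = 0\<^sub>v m" if "x \<in> carrier_vec n" for x
    by (rule append_rows_mult_vec_eq_0_iff[OF E C that])
  have C0: "?E *\<^sub>v x = E *\<^sub>v x" if "x \<in> carrier_vec n" "C *\<^sub>v x = 0\<^sub>v m" for x
    unfolding fb[OF that(1)] that(2) using E that
    by (simp add: mult_mat_zero_vec[OF K] mult_mat_zero_vec[OF B])
  have FE: "?E *\<^sub>v x = 0\<^sub>v n" if "x \<in> carrier_vec n" "?F *\<^sub>v x = 0\<^sub>v (n + m)" for x
    using C0[OF that(1)] that(2) unfolding F0[OF that(1)] by simp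
  show "mat_rank (four_block_mat E (A * S) C (0\<^sub>m m (dim_col S))) = n"
    unfolding rank_feedback_block_iff[OF E A C S]
  proof (intro ballI impI)
    fix z x :: "real vec" assume zx: "z \<in> carrier_vec n" "x \<in> carrier_vec n"
      and "E *\<^sub>v z = 0\<^sub>v n" "C *\<^sub>v z = 0\<^sub>v m" "C *\<^sub>v x = 0\<^sub>v m" "A *\<^sub>v z = E *\<^sub>v x"
    then have "?E *\<^sub>v z = 0\<^sub>v n" "A *\<^sub>v z = ?E *\<^sub>v x" using C0 by auto
    then show "z = 0\<^sub>v n" using sep zx unfolding separated_pencil_def by blast
  qed
  have sub: "mat_kernel ?F \<subseteq> mat_kernel ?E"
    using FE mat_kernelD[OF F] mat_kernelI[OF EK] by blast
  have "dim_row ?E = n" using B by simp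
  then have ker: "mat_kernel ?F = mat_kernel ?E"
    using rank rank_antimono_kernel(2)[OF F EK sub] by simp
  have EF: "?F *\<^sub>v x = 0\<^sub>v (n + m)" if "x \<in> carrier_vec n" "?E *\<^sub>v x = 0\<^sub>v n" for x
    using mat_kernelI[OF EK that] mat_kernelD(2)[OF F] unfolding ker by blast
  have AS: "A * S \<in> carrier_mat n k" using A Sd(1) by simp
  have D: "append_cols ?E (A * S) \<in> carrier_mat n (n + k)" by (rule append_cols_carrier[OF EK AS])
  have "vec_space.rank n (append_cols ?E (A * S)) = n"
  proof (rule iffD2[OF rank_append_cols_eq_iff[OF F EK AS S k_def]], erule (1) FE, intro ballI impI)
    fix x y :: "real vec" assume xy: "x \<in> carrier_vec n" "y \<in> carrier_vec k"
      and zero: "?E *\<^sub>v x + A * S *\<^sub>v y = 0\<^sub>v n"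
    let ?z = "S *\<^sub>v y"
    have z: "?z \<in> carrier_vec n" using Sd(1) xy by simp
    have zero': "?E *\<^sub>v x + A *\<^sub>v ?z = 0\<^sub>v n" using zero assoc_mult_mat_vec[OF A Sd(1) xy(2)] by simp
    then have "A *\<^sub>v ?z = ?E *\<^sub>v (- x)"
      using mult_vec_add_eq_0_iff[OF EK A xy(1) z] by blast
    moreover have "?E *\<^sub>v ?z = 0\<^sub>v n" by (rule FE[OF z Sd(2)[OF xy(2)]])
    moreover have "- x \<in> carrier_vec n" using xy by simp
    ultimately have z0: "?z = 0\<^sub>v n" using sep z unfolding separated_pencil_def by blast
    have "?E *\<^sub>v x = 0\<^sub>v n"
      using zero' mult_mat_vec_carrier[OF EK xy(1)] unfolding z0 mult_mat_zero_vec[OF A] by simp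
    then show "?F *\<^sub>v x = 0\<^sub>v (n + m) \<and> y = 0\<^sub>v k" using EF[OF xy(1)] Sd(4)[OF xy(2) z0] by blast
  qed
  \<comment> \<open>Surjectivity survives when the feedback term is replaced by the free input block \<open>B\<close>.\<close>
  then have surj: "\<forall>w\<in>carrier_vec n. \<exists>u\<in>carrier_vec (n + k). append_cols ?E (A * S) *\<^sub>v u = w"
    unfolding rank_eq_dim_row_iff_surj[OF D] .
  show "mat_rank (append_cols (append_cols E (A * S)) B) = n"
    unfolding rank_triple_block_iff[OF E A B Sd(1)]
  proof
    fix w :: "real vec" assume "w \<in> carrier_vec n"
    then obtain u where u: "u \<in> carrier_vec (n + k)" "append_cols ?E (A * S) *\<^sub>v u = w" using surj by blast
    obtain x y where xy: "x \<in> carrier_vec n" "y \<in> carrier_vec k" "u = x @\<^sub>v y" using u(1) by (rule vec_split_append)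
    let ?v = "K *\<^sub>v (C *\<^sub>v x)"
    have v: "?v \<in> carrier_vec m" using K C xy by simp
    have c: "E *\<^sub>v x \<in> carrier_vec n" "A *\<^sub>v (S *\<^sub>v y) \<in> carrier_vec n" "B *\<^sub>v ?v \<in> carrier_vec n"
      using E A B Sd(1) xy v by auto
    have "w = E *\<^sub>v x + B *\<^sub>v ?v + A *\<^sub>v (S *\<^sub>v y)"
      using u(2) unfolding xy(3) append_cols_mult_vec[OF EK AS xy(1,2)] fb[OF xy(1)] assoc_mult_mat_vec[OF A Sd(1) xy(2)] by simp
    also have "\<dots> = E *\<^sub>v x + A *\<^sub>v (S *\<^sub>v y) + B *\<^sub>v ?v"
      unfolding assoc_add_vec[OF c(1,3,2)] assoc_add_vec[OF c(1,2,3)] comm_add_vec[OF c(3,2)] ..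
    finally show "\<exists>x\<in>carrier_vec n. \<exists>y\<in>carrier_vec k. \<exists>v\<in>carrier_vec m. w = E *\<^sub>v x + A *\<^sub>v (S *\<^sub>v y) + B *\<^sub>v v"
      using xy v by blast
  qed
qed

text \<open>
  Suppose \<open>(E + B C) z = 0\<close> and \<open>A z = (E + B C) x\<close>. Pairing with \<open>Q z\<close> shows that
  \<open>z\<close> does not dissipate, and then \<open>Q z\<close> is orthogonal to everything that spans the space by
  the second rank condition. So \<open>Q z = 0\<close>, hence \<open>A z = 0\<close>, and the first rank condition
  with \<open>x = 0\<close> yields \<open>z = 0\<close>. The same argument applies to a solution of
  \<open>(E + B C) z = A z\<close>, which gives regularity.
\<close>

lemma unit_feedback_regular_separated:
  fixes E A B C S :: "real mat"
  assumes ph: "port_hamiltonian n m E A B C"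
    and S: "right_null_basis (E @\<^sub>r C) S"
    and rank1: "mat_rank (four_block_mat E (A * S) C (0\<^sub>m m (dim_col S))) = n"
    and rank2: "mat_rank (append_cols (append_cols E (A * S)) B) = n"
  shows "regular_pencil (E + B * 1\<^sub>m m * C) A" and "separated_pencil n (E + B * 1\<^sub>m m * C) A"
proof -
  let ?E = "E + B * 1\<^sub>m m * C"
  have E: "E \<in> carrier_mat n n" and A: "A \<in> carrier_mat n n" and B: "B \<in> carrier_mat n m" and C: "C \<in> carrier_mat m n"
    using ph unfolding port_hamiltonian_def by blast+
  define k where "k = dim_col S"
  have F: "E @\<^sub>r C \<in> carrier_mat (n + m) n" using E C by simp
  note Sd = right_null_basisD[OF S F k_def]
  have EK: "?E \<in> carrier_mat n n" using E mult_carrier_mat[OF mult_carrier_mat[OF B one_carrier_mat] C] by simp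
  have fb: "?E *\<^sub>v x = E *\<^sub>v x + B *\<^sub>v (C *\<^sub>v x)" if "x \<in> carrier_vec n" for x
    using feedback_mult_vec[OF E B one_carrier_mat C that] C that by simp
  have ker: "E *\<^sub>v x = 0\<^sub>v n" "C *\<^sub>v x = 0\<^sub>v m" if "x \<in> carrier_vec n" "?E *\<^sub>v x = 0\<^sub>v n" for x
    using port_hamiltonian_kernel_unit_feedback[OF ph that(1)] that(2) unfolding fb[OF that(1)] by blast+
  obtain Q where "dissipative_form n m E A B C Q" using port_hamiltonian_imp_dissipative_form[OF ph] by blast
  then interpret dissipative_form n m E A B C Q .
  have Qc: "Q *\<^sub>v x \<in> carrier_vec n" and Ec: "E *\<^sub>v x \<in> carrier_vec n" and Ac: "A *\<^sub>v x \<in> carrier_vec n"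
    and Cc: "C *\<^sub>v x \<in> carrier_vec m" and BCc: "B *\<^sub>v (C *\<^sub>v x) \<in> carrier_vec n"
    if "x \<in> carrier_vec n" for x using Q_carrier E A B C that by auto
  have QE1: "(Q *\<^sub>v x) \<bullet> (?E *\<^sub>v y) = (Q *\<^sub>v x) \<bullet> (E *\<^sub>v y) + (C *\<^sub>v x) \<bullet> (C *\<^sub>v y)"
    if "x \<in> carrier_vec n" "y \<in> carrier_vec n" for x y
    unfolding fb[OF that(2)] scalar_prod_add_distrib[OF Qc[OF that(1)] Ec[OF that(2)] BCc[OF that(2)]]
      B_adjoint[OF that(1) Cc[OF that(2)]] ..
  have cond1: "z = 0\<^sub>v n" if "z \<in> carrier_vec n" "?E *\<^sub>v z = 0\<^sub>v n" "A *\<^sub>v z = 0\<^sub>v n" for z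
  proof -
    have "E *\<^sub>v 0\<^sub>v n = 0\<^sub>v n" "C *\<^sub>v 0\<^sub>v n = 0\<^sub>v m" by (rule mult_mat_zero_vec[OF E], rule mult_mat_zero_vec[OF C])
    then show ?thesis
      using rank1 ker[OF that(1,2)] that(1,3) zero_carrier_vec unfolding rank_feedback_block_iff[OF E A C S] by metis
  qed
  \<comment> \<open>The second rank condition says that no nonzero vector is orthogonal to the ranges of
    \<open>E\<close>, \<open>B\<close> and to the image under \<open>A\<close> of the common kernel of \<open>E\<close> and \<open>C\<close>.\<close>
  have orth: "w = 0\<^sub>v n"
    if w: "w \<in> carrier_vec n" and wE: "\<And>x. x \<in> carrier_vec n \<Longrightarrow> w \<bullet> (E *\<^sub>v x) = 0"
      and wB: "\<And>v. v \<in> carrier_vec m \<Longrightarrow> w \<bullet> (B *\<^sub>v v) = 0"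
      and wA: "\<And>z. z \<in> carrier_vec n \<Longrightarrow> E *\<^sub>v z = 0\<^sub>v n \<Longrightarrow> C *\<^sub>v z = 0\<^sub>v m \<Longrightarrow> w \<bullet> (A *\<^sub>v z) = 0" for w
  proof -
    obtain x y v where xyv: "x \<in> carrier_vec n" "y \<in> carrier_vec k" "v \<in> carrier_vec m"
      and weq: "w = E *\<^sub>v x + A *\<^sub>v (S *\<^sub>v y) + B *\<^sub>v v"
      using rank2 w unfolding rank_triple_block_iff[OF E A B Sd(1)] by blast
    have Sy: "S *\<^sub>v y \<in> carrier_vec n" using Sd(1) xyv by simp
    have Bv: "B *\<^sub>v v \<in> carrier_vec n" using B xyv by simp
    have "E *\<^sub>v (S *\<^sub>v y) = 0\<^sub>v n" "C *\<^sub>v (S *\<^sub>v y) = 0\<^sub>v m"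
      using Sd(2)[OF xyv(2)] append_rows_mult_vec_eq_0_iff[OF E C Sy] by blast+
    then have "w \<bullet> (E *\<^sub>v x + A *\<^sub>v (S *\<^sub>v y) + B *\<^sub>v v) = 0"
      using wE[OF xyv(1)] wA[OF Sy] wB[OF xyv(3)] w Ec[OF xyv(1)] Ac[OF Sy] Bv
      by (simp add: scalar_prod_add_distrib[of _ n])
    then show ?thesis using scalar_prod_self_eq_0_iff[OF w] weq by simp
  qed
  \<comment> \<open>The heart of the argument: \<open>Q z\<close> is such an orthogonal vector. Orthogonality to \<open>A y\<close>
    uses that \<open>A\<close> is skew along \<open>z\<close>, which turns the product into one of \<open>Q y\<close> with
    \<open>A z\<close>, an element of the range of the closed-loop matrix.\<close>
  have trivial: "z = 0\<^sub>v n"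
    if z: "z \<in> carrier_vec n" and x: "x \<in> carrier_vec n" and Az: "A *\<^sub>v z = ?E *\<^sub>v x"
      and QAz: "(Q *\<^sub>v z) \<bullet> (A *\<^sub>v z) = 0" and QEz: "(Q *\<^sub>v z) \<bullet> (E *\<^sub>v z) = 0" and Cz: "C *\<^sub>v z = 0\<^sub>v m"
      and last: "A *\<^sub>v z = 0\<^sub>v n \<Longrightarrow> ?E *\<^sub>v z = 0\<^sub>v n" for z x
  proof -
    have "Q *\<^sub>v z = 0\<^sub>v n"
    proof (rule orth[OF Qc[OF z]])
      show "(Q *\<^sub>v z) \<bullet> (E *\<^sub>v y) = 0" if "y \<in> carrier_vec n" for y by (rule E_null[OF z that QEz])
      show "(Q *\<^sub>v z) \<bullet> (B *\<^sub>v v) = 0" if "v \<in> carrier_vec m" for v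
        unfolding B_adjoint[OF z that] Cz using that by simp
      show "(Q *\<^sub>v z) \<bullet> (A *\<^sub>v y) = 0" if y: "y \<in> carrier_vec n" "E *\<^sub>v y = 0\<^sub>v n" "C *\<^sub>v y = 0\<^sub>v m" for y
      proof -
        have "(Q *\<^sub>v z) \<bullet> (A *\<^sub>v y) = - ((Q *\<^sub>v y) \<bullet> (?E *\<^sub>v x))"
          using A_skew_on_null[OF z y(1) QAz] unfolding Az .
        also have "(Q *\<^sub>v y) \<bullet> (?E *\<^sub>v x) = 0"
          unfolding QE1[OF y(1) x] E_sym[OF y(1) x] y(2,3) using Qc[OF x] Cc[OF x] by simp
        finally show ?thesis by simp
      qed
    qed
    then have "A *\<^sub>v z = 0\<^sub>v n" by (rule ker_Q[OF z])
    then show ?thesis using cond1[OF z] last by blast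
  qed
  show sep: "separated_pencil n ?E A" unfolding separated_pencil_def
  proof (intro ballI impI)
    fix z x :: "real vec" assume z: "z \<in> carrier_vec n" and x: "x \<in> carrier_vec n"
      and Ez: "?E *\<^sub>v z = 0\<^sub>v n" and Az: "A *\<^sub>v z = ?E *\<^sub>v x"
    note k = ker[OF z Ez]
    have "(Q *\<^sub>v z) \<bullet> (A *\<^sub>v z) = 0"
      unfolding Az QE1[OF z x] E_sym[OF z x] k using Qc[OF x] Cc[OF x] by simp
    moreover have "(Q *\<^sub>v z) \<bullet> (E *\<^sub>v z) = 0" unfolding k using Qc[OF z] by simp
    ultimately show "z = 0\<^sub>v n" using trivial[OF z x Az _ _ k(2)] Ez by blast
  qed
  \<comment> \<open>For regularity it suffices that \<open>s = 1\<close> is no eigenvalue. An eigenvector would be a growing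
    mode, which a dissipative system permits only if the mode stores no energy.\<close>
  have inj: "v = 0\<^sub>v n" if v: "v \<in> carrier_vec n" and eq: "A *\<^sub>v v = ?E *\<^sub>v v" for v
  proof -
    have "(Q *\<^sub>v v) \<bullet> (E *\<^sub>v v) + (C *\<^sub>v v) \<bullet> (C *\<^sub>v v) \<le> 0"
      using A_nonpos[OF v] unfolding eq QE1[OF v v] .
    then have 0: "(Q *\<^sub>v v) \<bullet> (E *\<^sub>v v) = 0" "(C *\<^sub>v v) \<bullet> (C *\<^sub>v v) = 0"
      using E_nonneg[OF v] scalar_prod_self_nonneg[of "C *\<^sub>v v"] by linarith+
    have "(Q *\<^sub>v v) \<bullet> (A *\<^sub>v v) = 0" unfolding eq QE1[OF v v] 0 by simp
    moreover have "C *\<^sub>v v = 0\<^sub>v m" using 0(2) scalar_prod_self_eq_0_iff[OF Cc[OF v]] by blast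
    ultimately show ?thesis using trivial[OF v v eq _ 0(1)] eq by simp
  qed
  have EA: "?E - A \<in> carrier_mat n n" using A by (rule minus_carrier_mat)
  have "det (?E - A) \<noteq> 0"
  proof
    assume "det (?E - A) = 0"
    then obtain v where v: "v \<in> carrier_vec n" "v \<noteq> 0\<^sub>v n" "(?E - A) *\<^sub>v v = 0\<^sub>v n"
      using det_0_iff_vec_prod_zero_field[OF EA] by blast
    have Ev: "?E *\<^sub>v v \<in> carrier_vec n" using EK v by simp
    have diff: "?E *\<^sub>v v - A *\<^sub>v v = 0\<^sub>v n" using v(3) minus_mult_distrib_mat_vec[OF EK A v(1)] by simp
    have "A *\<^sub>v v = ?E *\<^sub>v v" by (rule vec_minus_eq_0D[OF Ev Ac[OF v(1)] diff, symmetric])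
    then show False using inj[OF v(1)] v(2) by blast
  qed
  then show "regular_pencil ?E A" by (rule regular_pencil_if_det_minus[OF EK A])
qed

theorem theorem2:
  fixes n m :: nat and E A B C S :: "real mat"
  assumes "E \<in> carrier_mat n n" and "A \<in> carrier_mat n n"
    and "B \<in> carrier_mat n m" and "C \<in> carrier_mat m n"
    and "port_hamiltonian n m E A B C"
    and "right_null_basis (E @\<^sub>r C) S"
  shows "(\<exists>K \<in> carrier_mat m m.
            regular_pencil (E + B * K * C) A \<and>
            pencil_index (E + B * K * C) A \<le> 1 \<and>
            mat_rank (E + B * K * C) =
              Max ((\<lambda>K'. mat_rank (E + B * K' * C)) ` carrier_mat m m) \<and>
            port_hamiltonian n m (E + B * K * C) A B C)
         \<longleftrightarrow>
         mat_rank (four_block_mat E (A * S) C (0\<^sub>m m (dim_col S))) = n \<and>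
         mat_rank (append_cols (append_cols E (A * S)) B) = n"
proof -
  note EABC = assms(1-4) and ph = assms(5) and S = assms(6)
  have EK: "E + B * K * C \<in> carrier_mat n n" if "K \<in> carrier_mat m m" for K
    using EABC(1) mult_carrier_mat[OF mult_carrier_mat[OF EABC(3) that] EABC(4)] by simp
  note max = max_feedback_rank[OF ph]
  show ?thesis
  proof
    assume "\<exists>K \<in> carrier_mat m m.
            regular_pencil (E + B * K * C) A \<and>
            pencil_index (E + B * K * C) A \<le> 1 \<and>
            mat_rank (E + B * K * C) =
              Max ((\<lambda>K'. mat_rank (E + B * K' * C)) ` carrier_mat m m) \<and>
            port_hamiltonian n m (E + B * K * C) A B C"
    then obtain K where K: "K \<in> carrier_mat m m" and reg: "regular_pencil (E + B * K * C) A"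
      and ind: "pencil_index (E + B * K * C) A \<le> 1"
      and rank: "mat_rank (E + B * K * C) = vec_space.rank (n + m) (E @\<^sub>r C)"
      unfolding max(1) by blast
    have "separated_pencil n (E + B * K * C) A"
      using ind pencil_index_le_1_iff[OF EK[OF K] EABC(2) reg] by blast
    from feedback_rank_conditions_necessary[OF EABC K S this rank]
    show "mat_rank (four_block_mat E (A * S) C (0\<^sub>m m (dim_col S))) = n \<and>
         mat_rank (append_cols (append_cols E (A * S)) B) = n" by blast
  next
    assume ranks: "mat_rank (four_block_mat E (A * S) C (0\<^sub>m m (dim_col S))) = n \<and>
         mat_rank (append_cols (append_cols E (A * S)) B) = n"
    note unit = unit_feedback_regular_separated[OF ph S conjunct1[OF ranks] conjunct2[OF ranks]]
    have ind: "pencil_index (E + B * 1\<^sub>m m * C) A \<le> 1"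
      using unit(2) pencil_index_le_1_iff[OF EK[OF one_carrier_mat] EABC(2) unit(1)] by blast
    show "\<exists>K \<in> carrier_mat m m.
            regular_pencil (E + B * K * C) A \<and>
            pencil_index (E + B * K * C) A \<le> 1 \<and>
            mat_rank (E + B * K * C) =
              Max ((\<lambda>K'. mat_rank (E + B * K' * C)) ` carrier_mat m m) \<and>
            port_hamiltonian n m (E + B * K * C) A B C"
      unfolding max(1)
      by (intro bexI[of _ "1\<^sub>m m"] conjI unit(1) ind max(2) port_hamiltonian_output_feedback[OF ph] pos_semidef_one one_carrier_mat)
  qed
qed

end
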